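(* Let $H$ be a max-id.\ distribution function on $\mathbb{R}^d$ with unit Fréchet marginal df's, and let $Q$ be a $d$-dimensional df with unit Fréchet marginal df's (so $Q$ and $H$ have the same marginals). Then $$\mu(H,Q)=\lim_{n\to\infty} n\int_{\mathbb{R}^d}\bigl[1-H^{1/n}(x_1,\ldots,x_d)\bigr]\,dQ(x_1,\ldots,x_d),\qquad \lambda(Q,H)=\lim_{n\to\infty} n\int_{\mathbb{R}^d}Q(x_1,\ldots,x_d)\,dH^{1/n}(x_1,\ldots,x_d).$$ Moreover, $$\mu(H,Q)=d+\sum_{i=2}^d(-1)^{i+1}\sum_{K\subset\{1,\ldots,d\},\,|K|=i}\lambda(Q_K,H_K)$$ and $$\lambda(Q,H)=d+\sum_{i=2}^d(-1)^{i+1}\sum_{K\subset\{1,\ldots,d\},\,|K|=i}\mu(H_K,Q_K).$$ In particular, for $d=2$, $\mu(H,Q)=2-\lambda(Q,H)$.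
   Context: Unit Fréchet df: $\Phi(x)=e^{-1/x}$ for $x>0$, $\Phi(x)=0$ for $x\le 0$. A $d$-dimensional df $H$ is max-id.\ if $H^t$ is a df for every $t>0$. For a max-id.\ df $H$ with unit Fréchet marginals, its exponent measure $\upsilon$ is the measure on $E=[0,\infty]^d\setminus\{(0,\ldots,0)\}$ with $H(x)=\exp(-\upsilon(E\setminus[0,x]))$ for $x\in(0,\infty)^d$. For $d$-dimensional df's $H,Q$ with the same (unit Fréchet) marginals and $\vec Z=(Z_1,\ldots,Z_d)\sim Q$, define $\mu(H,Q)=-\mathbb{E}[\ln H(Z_1,\ldots,Z_d)]$ and $\lambda(Q,H)=\int_{(0,\infty)^d}Q\,d\upsilon$ where $\upsilon$ is the exponent measure of $H$. For a nonempty $K\subset\{1,\ldots,d\}$, $H_K,Q_K$ denote the marginal df's of $H,Q$ of the coordinates in $K$, and $|K|$ the cardinality of $K$. *)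

theory Defs
  imports "HOL-Probability.Probability"
begin

text \<open>Points of R^d are functions nat => real; only the coordinates in the
index set I (in the theorem I = {1..d}) matter.\<close>

definition frechet :: "real \<Rightarrow> real" where
  "frechet t = (if t > 0 then exp (- 1 / t) else 0)"

definition is_df :: "nat set \<Rightarrow> ((nat \<Rightarrow> real) \<Rightarrow> real) \<Rightarrow> bool" where
  "is_df I F \<longleftrightarrow> (\<exists>M. prob_space M \<and> sets M = sets (PiM I (\<lambda>_. borel)) \<and>
      (\<forall>x. F x = measure M (PiE I (\<lambda>i. {..x i}))))"

text \<open>The probability measure dF induced by a df F (unique when it exists).\<close>
definition df_measure :: "nat set \<Rightarrow> ((nat \<Rightarrow> real) \<Rightarrow> real) \<Rightarrow> (nat \<Rightarrow> real) measure" where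
  "df_measure I F = (SOME M. prob_space M \<and> sets M = sets (PiM I (\<lambda>_. borel)) \<and>
      (\<forall>x. F x = measure M (PiE I (\<lambda>i. {..x i}))))"

definition marg_df :: "nat set \<Rightarrow> ((nat \<Rightarrow> real) \<Rightarrow> real) \<Rightarrow> nat set \<Rightarrow> (nat \<Rightarrow> real) \<Rightarrow> real" where
  "marg_df I F K y = measure (df_measure I F) (PiE I (\<lambda>i. if i \<in> K then {..y i} else UNIV))"

definition unit_frechet_margins :: "nat set \<Rightarrow> ((nat \<Rightarrow> real) \<Rightarrow> real) \<Rightarrow> bool" where
  "unit_frechet_margins I F \<longleftrightarrow> (\<forall>i\<in>I. \<forall>t. marg_df I F {i} (\<lambda>_. t) = frechet t)"

definition max_id :: "nat set \<Rightarrow> ((nat \<Rightarrow> real) \<Rightarrow> real) \<Rightarrow> bool" where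
  "max_id I H \<longleftrightarrow> is_df I H \<and> (\<forall>t>0. is_df I (\<lambda>x. H x powr t))"

definition E_set :: "nat set \<Rightarrow> (nat \<Rightarrow> ereal) set" where
  "E_set I = PiE I (\<lambda>_. {0..\<infinity>}) - {restrict (\<lambda>_. 0) I}"

text \<open>upsilon is an exponent measure of H: a measure on (the Borel sets of) E with
H(x) = exp(-upsilon(E - [0,x])) for x in (0,\<infinity>)^I (with exp(-\<infinity>) = 0).\<close>
definition is_exponent_measure :: "nat set \<Rightarrow> ((nat \<Rightarrow> real) \<Rightarrow> real) \<Rightarrow> (nat \<Rightarrow> ereal) measure \<Rightarrow> bool" where
  "is_exponent_measure I H \<upsilon> \<longleftrightarrow>
     sets \<upsilon> = sets (PiM I (\<lambda>_. (borel :: ereal measure))) \<and>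
     emeasure \<upsilon> (space \<upsilon> - E_set I) = 0 \<and>
     (\<forall>x \<in> PiE I (\<lambda>_. {0<..}).
        (let A = E_set I - PiE I (\<lambda>i. {0..ereal (x i)}) in
          (emeasure \<upsilon> A < \<infinity> \<and> H x = exp (- enn2real (emeasure \<upsilon> A))) \<or>
          (emeasure \<upsilon> A = \<infinity> \<and> H x = 0)))"

definition exponent_measure :: "nat set \<Rightarrow> ((nat \<Rightarrow> real) \<Rightarrow> real) \<Rightarrow> (nat \<Rightarrow> ereal) measure" where
  "exponent_measure I H = (SOME \<upsilon>. is_exponent_measure I H \<upsilon>)"

definition mu :: "nat set \<Rightarrow> ((nat \<Rightarrow> real) \<Rightarrow> real) \<Rightarrow> ((nat \<Rightarrow> real) \<Rightarrow> real) \<Rightarrow> real" where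
  "mu I H Q = - (\<integral>x. ln (H x) \<partial>(df_measure I Q))"

definition lam :: "nat set \<Rightarrow> ((nat \<Rightarrow> real) \<Rightarrow> real) \<Rightarrow> ((nat \<Rightarrow> real) \<Rightarrow> real) \<Rightarrow> real" where
  "lam I Q H = (LINT x : PiE I (\<lambda>_. {0<..<\<infinity>}) | exponent_measure I H. Q (\<lambda>i. real_of_ereal (x i)))"

end

theory Submission
  imports Defs
begin

text \<open>Everything follows from two identities of Fubini type. If Z has df Q and N is a measure with
  N(some w_i > z_i, i in T) = V_T(z), then inclusion-exclusion under the integral sign turns
  the N-integral of Q into the alternating sum over nonempty T of the Q-integrals of V_T; the difference
  between strict and weak inequalities is harmless because the margins are continuous. With N the exponent
  measure, V_T = -ln H_T, this expresses lambda through the mu of the marginals, and Moebius inversion gives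
  the converse formula. With N the distribution of H^{1/n}, V_T = 1 - H_T^{1/n}, and n times this tends to
  -ln H_T, dominated by the sum of the 1/z_i, which has Q-expectation |T|; hence both limits.

  The exponent measure exists as the limit of n times the distributions with df H^{1/n}: outside a box
  around the origin these have convergent finite masses and convergent values on orthants.\<close>

section \<open>Inclusion-exclusion for measures\<close>

text \<open>The data come as masses of unions: the points exceeding z_i in some coordinate i of T
  have exponent mass -ln H_T(z), which is finite, whereas [0,z] without the origin has infinite
  mass. Integrating Q requires the mass of an intersection of exceedances, so inclusion-exclusion is
  used in its dual form, from unions to intersections. Integrability of every term rests on one
  fact: if Z is unit Frechet, then 1/Z is standard exponential, so E(1/Z) = 1. The union bound
  controls V_T by the sum of the 1/z_i, and the singletons, where the mean is exactly 1, supply the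
  summand d. Laws and exponent measures are chosen by \<open>SOME\<close>. A law is pinned down by
  its orthant probabilities; lambda is computed from the defining property alone, so its value is
  the same for whichever exponent measure is chosen, but existence must be proved before that
  property is available. In the construction the laws of H^{1/n} are conditioned on the complement
  of a box: the mass there is of order 1/n, as are the masses of its parts, so the conditional
  probabilities have a limit.\<close>

lemma measure_INTER_inclusion_exclusion:
  fixes A :: "'i \<Rightarrow> 'a set"
  assumes fin: "finite I" and ne: "I \<noteq> {}" and A: "\<And>i. i \<in> I \<Longrightarrow> A i \<in> fmeasurable M"
  shows "measure M (\<Inter>i\<in>I. A i) = (\<Sum>T\<in>Pow I - {{}}. (-1) ^ (card T + 1) * measure M (\<Union>i\<in>T. A i))"
proof -
  interpret Incl_Excl "\<lambda>S. S \<in> fmeasurable M" "measure M"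
    by unfold_locales (auto simp: disjnt_def fmeasurableD fmeasurableD2 fmeasurable_Int_fmeasurable
        intro!: measure_Union fmeasurable.Un fmeasurable.Diff)
  \<comment> \<open>The inversion theorem wants its relation for every finite index set, not only
    for subsets of \<open>I\<close>; extending by the empty set keeps all sets measurable with
    finite mass.\<close>
  define B where "B i = (if i \<in> I then A i else {})" for i
  have B: "B i \<in> fmeasurable M" for i
    using A by (auto simp: B_def)
  \<comment> \<open>The value 0 at the empty index set replaces the empty intersection, which would
    be the whole type. The minus sign in \<open>g\<close> turns the factor (-1)^(card T + 1) into
    the (-1)^(card T) of the self-inverse relation.\<close>
  define f where "f T = (if T = {} then 0 else measure M (\<Inter>i\<in>T. B i))" for T
  define g where "g T = (if T = {} then 0 else - measure M (\<Union>i\<in>T. B i))" for T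
  have *: "g S = (\<Sum>T\<in>Pow S. (-1) ^ card T * f T)" if "finite S" for S
  proof -
    have "measure M (\<Union>i\<in>S. B i) = (\<Sum>T | T \<subseteq> S \<and> T \<noteq> {}. (-1) ^ (card T + 1) * measure M (\<Inter>i\<in>T. B i))"
      by (rule restricted_indexed) (use that B in auto)
    also have "\<dots> = - (\<Sum>T | T \<subseteq> S \<and> T \<noteq> {}. (-1) ^ card T * f T)"
      by (simp add: f_def sum_negf)
    also have "(\<Sum>T | T \<subseteq> S \<and> T \<noteq> {}. (-1) ^ card T * f T) = (\<Sum>T\<in>Pow S. (-1) ^ card T * f T)"
      by (rule sum.mono_neutral_left) (use that in \<open>auto simp: f_def\<close>)
    finally show ?thesis by (auto simp: g_def f_def)
  qed
  have "f I = (\<Sum>T\<in>Pow I. (-1) ^ card T * g T)"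
    by (rule inclusion_exclusion_symmetric[OF * fin])
  also have "\<dots> = (\<Sum>T\<in>Pow I - {{}}. (-1) ^ card T * g T)"
    by (rule sum.mono_neutral_right) (use fin in \<open>auto simp: g_def\<close>)
  also have "\<dots> = (\<Sum>T\<in>Pow I - {{}}. (-1) ^ (card T + 1) * measure M (\<Union>i\<in>T. A i))"
    by (intro sum.cong refl) (auto simp: g_def B_def intro!: arg_cong[where f="measure M"])
  finally show ?thesis
    using ne by (simp add: f_def B_def)
qed

text \<open>Tonelli for the set of pairs (w,z) with z below \<open>X\<close> at w: the section at w
  has \<open>Q\<close>-mass equal to the df at that point, the section at z has the
  \<open>N\<close>-mass of an intersection of exceedances. General functions \<open>X\<close> in
  place of coordinates cover both the law of a power of \<open>H\<close> and, through
  \<open>real_of_ereal\<close>, the exponent measure.\<close>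

lemma integral_df_inclusion_exclusion:
  fixes X :: "'i \<Rightarrow> 'a \<Rightarrow> real" and Q :: "('i \<Rightarrow> real) measure" and V :: "'i set \<Rightarrow> ('i \<Rightarrow> real) \<Rightarrow> real"
  assumes fin: "finite I" and ne: "I \<noteq> {}" and N: "sigma_finite_measure N" and Q: "prob_space Q"
    and sQ: "sets Q = sets (PiM I (\<lambda>_. borel))"
    and X[measurable]: "\<And>i. i \<in> I \<Longrightarrow> X i \<in> borel_measurable N"
    and pos: "AE z in Q. \<forall>i\<in>I. 0 < z i"
    and V: "\<And>T z. \<lbrakk>T \<subseteq> I; T \<noteq> {}; \<forall>i\<in>I. 0 < z i\<rbrakk> \<Longrightarrow>
       emeasure N {w\<in>space N. \<exists>i\<in>T. z i < X i w} = ennreal (V T z)"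
    and V0: "\<And>T z. \<lbrakk>T \<subseteq> I; T \<noteq> {}; \<forall>i\<in>I. 0 < z i\<rbrakk> \<Longrightarrow> 0 \<le> V T z"
    and atom: "\<And>i t. \<lbrakk>i \<in> I; 0 < t\<rbrakk> \<Longrightarrow> emeasure N {w\<in>space N. X i w = t} = 0"
    and intV: "\<And>T. \<lbrakk>T \<subseteq> I; T \<noteq> {}\<rbrakk> \<Longrightarrow> integrable Q (V T)"
  shows "(\<integral>w. measure Q {z\<in>space Q. \<forall>i\<in>I. z i \<le> X i w} \<partial>N) =
     (\<Sum>T\<in>Pow I - {{}}. (-1) ^ (card T + 1) * (\<integral>z. V T z \<partial>Q))"
proof -
  interpret N: sigma_finite_measure N by fact
  interpret Q: prob_space Q by fact
  interpret P: pair_sigma_finite N Q ..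
  note sQ[measurable_cong]
  note fin[measurable]
  let ?S = "\<lambda>z. \<Sum>T\<in>Pow I - {{}}. (-1) ^ (card T + 1) * V T z"
  have [measurable]: "(\<lambda>z. z i) \<in> borel_measurable Q" if "i \<in> I" for i
    using that by measurable
  define D where "D = {p \<in> space (N \<Otimes>\<^sub>M Q). \<forall>i\<in>I. snd p i \<le> X i (fst p)}"
  have D[measurable]: "D \<in> sets (N \<Otimes>\<^sub>M Q)"
    unfolding D_def using fin by measurable
  \<comment> \<open>Nonnegativity of the alternating sum is recorded as well: without it
    \<open>ennreal\<close> would truncate and the return to real integrals would fail.\<close>
  have 1: "emeasure N {w\<in>space N. \<forall>i\<in>I. z i \<le> X i w} = ennreal (?S z) \<and> 0 \<le> ?S z"
    if z: "\<forall>i\<in>I. 0 < z i" for z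
  proof -
    let ?A = "\<lambda>i. {w\<in>space N. z i < X i w}"
    have A: "?A i \<in> fmeasurable N" if i: "i \<in> I" for i
    proof (rule fmeasurableI)
      show "?A i \<in> sets N" using i by measurable
      show "emeasure N (?A i) < \<infinity>" using V[of "{i}" z] i z by simp
    qed
    have "{w\<in>space N. \<forall>i\<in>I. z i \<le> X i w} \<in> sets N"
      using fin by measurable
    moreover have "(\<Inter>i\<in>I. ?A i) \<in> sets N"
      using fin ne by (intro sets.finite_INT) measurable
    ultimately have eq: "{w\<in>space N. \<forall>i\<in>I. z i \<le> X i w} \<in> sets N" "(\<Inter>i\<in>I. ?A i) \<in> sets N"
      by auto
    \<comment> \<open>Weak and strict exceedances differ only on the sets where some
      \<open>X i\<close> equals \<open>z i\<close>, which are null by \<open>atom\<close>.\<close>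
    have "emeasure N {w\<in>space N. \<forall>i\<in>I. z i \<le> X i w} = emeasure N (\<Inter>i\<in>I. ?A i)"
    proof (rule emeasure_eq_AE[OF _ eq])
      have "AE w in N. \<forall>i\<in>I. X i w \<noteq> z i"
      proof (rule AE_finite_allI[OF fin])
        fix i assume i: "i \<in> I"
        show "AE w in N. X i w \<noteq> z i"
          by (rule AE_I[where N="{w\<in>space N. X i w = z i}"])
            (use atom[OF i, of "z i"] z i in auto)
      qed
      then show "AE w in N. w \<in> {w\<in>space N. \<forall>i\<in>I. z i \<le> X i w} \<longleftrightarrow> w \<in> (\<Inter>i\<in>I. ?A i)"
        using AE_space by eventually_elim (use ne in \<open>auto simp: less_le\<close>)
    qed
    also obtain i where i: "i \<in> I" using ne by auto
    have "(\<Inter>i\<in>I. ?A i) \<in> fmeasurable N"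
      by (rule fmeasurableI2[OF A[OF i] _ eq(2)]) (use i in auto)
    then have "emeasure N (\<Inter>i\<in>I. ?A i) = ennreal (measure N (\<Inter>i\<in>I. ?A i))"
      by (intro emeasure_eq_ennreal_measure) (auto simp: fmeasurable_def)
    also have "measure N (\<Inter>i\<in>I. ?A i) = ?S z"
    proof (subst measure_INTER_inclusion_exclusion[OF fin ne A], assumption, intro sum.cong refl)
      fix T assume T: "T \<in> Pow I - {{}}"
      have "(\<Union>i\<in>T. ?A i) = {w\<in>space N. \<exists>i\<in>T. z i < X i w}" by auto
      then show "(-1) ^ (card T + 1) * measure N (\<Union>i\<in>T. ?A i) = (-1) ^ (card T + 1) * V T z"
        using V[of T z] V0[of T z] T z by (simp add: measure_def)
    qed
    finally show ?thesis
      using \<open>measure N (\<Inter>i\<in>I. ?A i) = ?S z\<close> measure_nonneg[of N "\<Inter>i\<in>I. ?A i"] by simp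
  qed
  have Snonneg: "AE z in Q. 0 \<le> ?S z" using pos by eventually_elim (use 1 in blast)
  have "(\<integral>\<^sup>+w. ennreal (measure Q {z\<in>space Q. \<forall>i\<in>I. z i \<le> X i w}) \<partial>N)
      = (\<integral>\<^sup>+w. \<integral>\<^sup>+z. indicator D (w, z) \<partial>Q \<partial>N)"
  proof (intro nn_integral_cong)
    fix w assume w: "w \<in> space N"
    have "(\<integral>\<^sup>+z. indicator D (w, z) \<partial>Q) = (\<integral>\<^sup>+z. indicator {z\<in>space Q. \<forall>i\<in>I. z i \<le> X i w} z \<partial>Q)"
      by (intro nn_integral_cong) (auto simp: D_def w space_pair_measure split: split_indicator)
    also have "\<dots> = emeasure Q {z\<in>space Q. \<forall>i\<in>I. z i \<le> X i w}"
      by (rule nn_integral_indicator) (use fin in measurable)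
    finally show "ennreal (measure Q {z\<in>space Q. \<forall>i\<in>I. z i \<le> X i w}) = (\<integral>\<^sup>+z. indicator D (w, z) \<partial>Q)"
      by (simp add: Q.emeasure_eq_measure)
  qed
  also have "\<dots> = (\<integral>\<^sup>+z. \<integral>\<^sup>+w. indicator D (w, z) \<partial>N \<partial>Q)"
    by (rule P.Fubini'[symmetric]) measurable
  also have "\<dots> = (\<integral>\<^sup>+z. ennreal (?S z) \<partial>Q)"
  proof (rule nn_integral_cong_AE, use pos AE_space in eventually_elim)
    fix z assume z: "\<forall>i\<in>I. 0 < z i" "z \<in> space Q"
    have "(\<integral>\<^sup>+w. indicator D (w, z) \<partial>N) = (\<integral>\<^sup>+w. indicator {w\<in>space N. \<forall>i\<in>I. z i \<le> X i w} w \<partial>N)"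
      by (intro nn_integral_cong) (auto simp: D_def z space_pair_measure split: split_indicator)
    also have "\<dots> = emeasure N {w\<in>space N. \<forall>i\<in>I. z i \<le> X i w}"
      by (rule nn_integral_indicator) (use fin in measurable)
    finally show "(\<integral>\<^sup>+w. indicator D (w, z) \<partial>N) = ennreal (?S z)"
      using 1[OF z(1)] by simp
  qed
  also have "\<dots> = ennreal (\<integral>z. ?S z \<partial>Q)"
  proof (rule nn_integral_eq_integral)
    show "integrable Q ?S"
      using intV by (intro Bochner_Integration.integrable_sum integrable_mult_right) auto
    show "AE z in Q. 0 \<le> ?S z" by (rule Snonneg)
  qed
  finally have "(\<integral>\<^sup>+w. ennreal (measure Q {z\<in>space Q. \<forall>i\<in>I. z i \<le> X i w}) \<partial>N) = ennreal (\<integral>z. ?S z \<partial>Q)" .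
  moreover have "0 \<le> (\<integral>z. ?S z \<partial>Q)"
    by (rule integral_nonneg_AE[OF Snonneg])
  moreover have "(\<lambda>w. measure Q {z\<in>space Q. \<forall>i\<in>I. z i \<le> X i w}) \<in> borel_measurable N"
  proof -
    have "(\<lambda>w. measure Q (Pair w -` D)) \<in> borel_measurable N"
      using Q.measurable_emeasure_Pair[OF D] unfolding measure_def by measurable
    then show ?thesis
      by (rule measurable_cong[THEN iffD1, rotated])
        (auto simp: D_def space_pair_measure intro!: arg_cong[where f="measure Q"])
  qed
  ultimately have "(\<integral>w. measure Q {z\<in>space Q. \<forall>i\<in>I. z i \<le> X i w} \<partial>N) = (\<integral>z. ?S z \<partial>Q)"
    by (intro integral_eq_nn_integral[THEN trans]) auto
  also have "\<dots> = (\<Sum>T\<in>Pow I - {{}}. (-1) ^ (card T + 1) * (\<integral>z. V T z \<partial>Q))"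
    using intV by (subst Bochner_Integration.integral_sum) (auto intro!: sum.cong)
  finally show ?thesis .
qed

section \<open>Distribution functions\<close>

lemma PiE_atMost_eq: "PiE I (\<lambda>i. {..x i}) = {z\<in>space (PiM I (\<lambda>_. borel :: real measure)). \<forall>i\<in>I. z i \<le> x i}"
  by (auto simp: space_PiM PiE_iff extensional_def)

lemma is_dfD:
  assumes "is_df I F"
  shows prob_space_df_measure: "prob_space (df_measure I F)"
    and sets_df_measure: "sets (df_measure I F) = sets (PiM I (\<lambda>_. borel))"
    and space_df_measure: "space (df_measure I F) = space (PiM I (\<lambda>_. borel))"
    and df_eq_measure: "F x = measure (df_measure I F) {z\<in>space (df_measure I F). \<forall>i\<in>I. z i \<le> x i}"
proof -
  have *: "prob_space (df_measure I F) \<and> sets (df_measure I F) = sets (PiM I (\<lambda>_. borel)) \<and>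
      (\<forall>x. F x = measure (df_measure I F) (PiE I (\<lambda>i. {..x i})))"
    using assms unfolding df_measure_def is_df_def by (rule someI_ex)
  then show "prob_space (df_measure I F)" and s: "sets (df_measure I F) = sets (PiM I (\<lambda>_. borel))"
    by auto
  then show "space (df_measure I F) = space (PiM I (\<lambda>_. borel))"
    by (intro sets_eq_imp_space_eq)
  then show "F x = measure (df_measure I F) {z\<in>space (df_measure I F). \<forall>i\<in>I. z i \<le> x i}"
    using * by (simp add: PiE_atMost_eq)
qed

lemma df_measurable:
  assumes "is_df I F" "i \<in> I"
  shows "(\<lambda>z. z i) \<in> borel_measurable (df_measure I F)"
  using assms(2) by (simp add: sets_df_measure[OF assms(1)] cong: measurable_cong_sets)

lemma sets_orthant:
  fixes y :: "'i \<Rightarrow> real"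
  assumes "finite T" "T \<subseteq> I" "sets M = sets (PiM I (\<lambda>_. borel))"
  shows "{z\<in>space M. \<forall>i\<in>T. z i \<le> y i} \<in> sets M"
proof -
  have "(\<lambda>z. z i) \<in> borel_measurable M" if "i \<in> T" for i
    using assms that by (auto cong: measurable_cong_sets)
  then show ?thesis using assms(1) by (intro sets.sets_Collect_finite_All) auto
qed

lemma df_nonneg: "is_df I F \<Longrightarrow> 0 \<le> F x"
  using df_eq_measure[of I F x] by simp

lemma df_le_1: "is_df I F \<Longrightarrow> F x \<le> 1"
  using df_eq_measure[of I F x] prob_space.prob_le_1[OF prob_space_df_measure] by simp

lemma df_cong:
  assumes "is_df I F" "\<And>i. i \<in> I \<Longrightarrow> x i = y i"
  shows "F x = F y"
  using df_eq_measure[OF assms(1), of x] df_eq_measure[OF assms(1), of y] assms(2)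
  by (simp cong: conj_cong)

text \<open>Lower orthants form an intersection-stable generator of the product sigma-algebra, and
  those with all bounds equal to n exhaust the space, so a df determines its law. This makes the
  choice in \<open>df_measure\<close> harmless.\<close>

lemma df_measure_eqI:
  fixes I :: "nat set"
  assumes fin: "finite I" and "prob_space M" and M: "sets M = sets (PiM I (\<lambda>_. borel))"
    and "\<And>x. F x = measure M {z\<in>space M. \<forall>i\<in>I. z i \<le> x i}"
  shows "is_df I F" and "df_measure I F = M"
proof -
  have spM: "space M = space (PiM I (\<lambda>_. borel))" using M by (rule sets_eq_imp_space_eq)
  show F: "is_df I F"
    unfolding is_df_def using assms spM by (intro exI[of _ M]) (auto simp: PiE_atMost_eq)
  interpret M: prob_space M by fact
  interpret D: prob_space "df_measure I F" by (rule prob_space_df_measure[OF F])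
  let ?E = "{{z\<in>\<Pi>\<^sub>E i\<in>I. UNIV. \<forall>i\<in>I. z i \<le> x i} | x :: nat \<Rightarrow> real. True}"
  have gen: "sets (PiM I (\<lambda>_. borel :: real measure)) = sigma_sets (\<Pi>\<^sub>E i\<in>I. UNIV) ?E"
  proof -
    have cover: "\<exists>S\<subseteq>range (\<lambda>a. {..a::real}). countable S \<and> UNIV = \<Union>S"
      by (rule exI[of _ "range (\<lambda>n. {..real n})"]) (auto intro: real_arch_simple)
    have "sets (PiM I (\<lambda>_. borel :: real measure)) = sets (PiM I (\<lambda>_. sigma UNIV (range (\<lambda>a. {..a::real}))))"
      by (simp add: borel_eq_atMost)
    also have "\<dots> = sets (sigma (\<Pi>\<^sub>E i\<in>I. UNIV)
        {{f\<in>\<Pi>\<^sub>E i\<in>I. UNIV. \<forall>i\<in>j. f i \<in> A i} | A j. j \<in> {I} \<and> A \<in> j \<rightarrow> range (\<lambda>a. {..a::real})})"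
      by (rule sets_PiM_sigma) (use cover fin in auto)
    also have "{{f\<in>\<Pi>\<^sub>E i\<in>I. UNIV. \<forall>i\<in>j. f i \<in> A i} | A j. j \<in> {I} \<and> A \<in> j \<rightarrow> range (\<lambda>a. {..a::real})} = ?E"
    proof (intro set_eqI iffI)
      fix X assume "X \<in> {{f\<in>\<Pi>\<^sub>E i\<in>I. UNIV. \<forall>i\<in>j. f i \<in> A i} | A j. j \<in> {I} \<and> A \<in> j \<rightarrow> range (\<lambda>a. {..a::real})}"
      then obtain A where A: "X = {f\<in>\<Pi>\<^sub>E i\<in>I. UNIV. \<forall>i\<in>I. f i \<in> A i}" "A \<in> I \<rightarrow> range (\<lambda>a. {..a::real})" by auto
      then have "\<forall>i\<in>I. \<exists>a. A i = {..a}" by auto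
      then obtain x where "\<forall>i\<in>I. A i = {..x i}" by metis
      then show "X \<in> ?E" using A(1) by (auto intro!: exI[of _ x])
    next
      fix X assume "X \<in> ?E"
      then obtain x where "X = {z\<in>\<Pi>\<^sub>E i\<in>I. UNIV. \<forall>i\<in>I. z i \<le> x i}" by auto
      then show "X \<in> {{f\<in>\<Pi>\<^sub>E i\<in>I. UNIV. \<forall>i\<in>j. f i \<in> A i} | A j. j \<in> {I} \<and> A \<in> j \<rightarrow> range (\<lambda>a. {..a::real})}"
        by (auto intro!: exI[of _ "\<lambda>i. {..x i}"])
    qed
    also have "sets (sigma (\<Pi>\<^sub>E i\<in>I. UNIV) ?E) = sigma_sets (\<Pi>\<^sub>E i\<in>I. UNIV) ?E"
      by (rule sets_measure_of) auto
    finally show ?thesis .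
  qed
  show "df_measure I F = M"
  proof (rule measure_eqI_generator_eq)
    show "Int_stable ?E"
    proof (rule Int_stableI, clarify)
      fix x y :: "nat \<Rightarrow> real"
      show "\<exists>w. {z\<in>\<Pi>\<^sub>E i\<in>I. UNIV. \<forall>i\<in>I. z i \<le> x i} \<inter> {z\<in>\<Pi>\<^sub>E i\<in>I. UNIV. \<forall>i\<in>I. z i \<le> y i}
          = {z\<in>\<Pi>\<^sub>E i\<in>I. UNIV. \<forall>i\<in>I. z i \<le> w i} \<and> True"
        by (rule exI[of _ "\<lambda>i. min (x i) (y i)"]) auto
    qed
    show "emeasure (df_measure I F) X = emeasure M X" if "X \<in> ?E" for X
    proof -
      obtain x where "X = {z\<in>\<Pi>\<^sub>E i\<in>I. UNIV. \<forall>i\<in>I. z i \<le> x i}" using \<open>X \<in> ?E\<close> by auto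
      then show ?thesis
        using df_eq_measure[OF F, of x] assms(4)[of x]
        by (simp add: D.emeasure_eq_measure M.emeasure_eq_measure spM space_df_measure[OF F] space_PiM)
    qed
    show "range (\<lambda>n. {z\<in>\<Pi>\<^sub>E i\<in>I. UNIV. \<forall>i\<in>I. z i \<le> real n}) \<subseteq> ?E" by auto
    show "(\<Union>n. {z\<in>\<Pi>\<^sub>E i\<in>I. UNIV. \<forall>i\<in>I. z i \<le> real n}) = (\<Pi>\<^sub>E i\<in>I. UNIV)"
    proof -
      have "\<exists>n. \<forall>i\<in>I. z i \<le> real n" for z :: "nat \<Rightarrow> real"
      proof -
        obtain n where n: "Max (insert 0 (z ` I)) \<le> real n" using real_arch_simple by blast
        have "z i \<le> real n" if "i \<in> I" for i
          using n Max_ge[of "insert 0 (z ` I)" "z i"] fin that by auto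
        then show ?thesis by blast
      qed
      then show ?thesis by auto
    qed
  qed (use gen M sets_df_measure[OF F] in auto)
qed

lemma marg_df_eq:
  assumes F: "is_df I F" and K: "K \<subseteq> I"
  shows "marg_df I F K y = measure (df_measure I F) {z\<in>space (df_measure I F). \<forall>i\<in>K. z i \<le> y i}"
  unfolding marg_df_def space_df_measure[OF F] using K
  by (intro arg_cong[where f="measure (df_measure I F)"]) (auto simp: space_PiM PiE_iff extensional_def split: if_splits)

lemma marg_df_self: "is_df I F \<Longrightarrow> marg_df I F I = F"
  by (rule ext) (simp add: marg_df_eq df_eq_measure[symmetric])

lemma
  assumes fin: "finite I" and F: "is_df I F" and K: "K \<subseteq> I"
  shows is_df_marg_df: "is_df K (marg_df I F K)"
    and df_measure_marg_df: "df_measure K (marg_df I F K) = distr (df_measure I F) (PiM K (\<lambda>_. borel)) (\<lambda>x. restrict x K)"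
proof -
  let ?D = "distr (df_measure I F) (PiM K (\<lambda>_. borel)) (\<lambda>x. restrict x K)"
  have r: "(\<lambda>x. restrict x K) \<in> measurable (df_measure I F) (PiM K (\<lambda>_. borel :: real measure))"
    using measurable_restrict_subset[OF K] by (simp add: sets_df_measure[OF F] cong: measurable_cong_sets)
  have 0: "finite K" using fin K finite_subset by auto
  have 1: "prob_space ?D"
    by (rule prob_space.prob_space_distr[OF prob_space_df_measure[OF F] r])
  have 2: "marg_df I F K x = measure ?D {z\<in>space ?D. \<forall>i\<in>K. z i \<le> x i}" for x
  proof -
    have "measure ?D {z\<in>space ?D. \<forall>i\<in>K. z i \<le> x i} =
        measure (df_measure I F) ((\<lambda>x. restrict x K) -` {z\<in>space ?D. \<forall>i\<in>K. z i \<le> x i} \<inter> space (df_measure I F))"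
      by (rule measure_distr[OF r]) (use sets_orthant[OF 0 order_refl, of ?D x] in simp)
    also have "(\<lambda>x. restrict x K) -` {z\<in>space ?D. \<forall>i\<in>K. z i \<le> x i} \<inter> space (df_measure I F)
       = {z\<in>space (df_measure I F). \<forall>i\<in>K. z i \<le> x i}"
      by (auto simp: space_PiM)
    finally show ?thesis unfolding marg_df_eq[OF F K] by (rule sym)
  qed
  show "is_df K (marg_df I F K)" "df_measure K (marg_df I F K) = ?D"
    using df_measure_eqI[OF 0 1 _ 2] by auto
qed

lemma marg_df_marg_df:
  assumes fin: "finite I" and F: "is_df I F" and K: "K \<subseteq> I" "T \<subseteq> K"
  shows "marg_df K (marg_df I F K) T = marg_df I F T"
proof
  fix y
  have r: "(\<lambda>x. restrict x K) \<in> measurable (df_measure I F) (PiM K (\<lambda>_. borel :: real measure))"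
    using measurable_restrict_subset[OF K(1)] by (simp add: sets_df_measure[OF F] cong: measurable_cong_sets)
  let ?D = "distr (df_measure I F) (PiM K (\<lambda>_. borel)) (\<lambda>x. restrict x K)"
  have 0: "finite T" using fin K by (meson finite_subset)
  have "marg_df K (marg_df I F K) T y = measure ?D {z\<in>space ?D. \<forall>i\<in>T. z i \<le> y i}"
    using marg_df_eq[OF is_df_marg_df[OF fin F K(1)] K(2)] df_measure_marg_df[OF fin F K(1)] by simp
  also have "\<dots> = measure (df_measure I F) ((\<lambda>x. restrict x K) -` {z\<in>space ?D. \<forall>i\<in>T. z i \<le> y i} \<inter> space (df_measure I F))"
    by (rule measure_distr[OF r]) (use sets_orthant[OF 0 K(2), of ?D y] in simp)
  also have "(\<lambda>x. restrict x K) -` {z\<in>space ?D. \<forall>i\<in>T. z i \<le> y i} \<inter> space (df_measure I F)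
     = {z\<in>space (df_measure I F). \<forall>i\<in>T. z i \<le> y i}"
    using K by (auto simp: space_PiM restrict_def)
  finally show "marg_df K (marg_df I F K) T y = marg_df I F T y"
    using marg_df_eq[OF F, of T] K by auto
qed

lemma unit_frechet_margins_marg_df:
  assumes "finite I" "is_df I F" "K \<subseteq> I" "unit_frechet_margins I F"
  shows "unit_frechet_margins K (marg_df I F K)"
  using assms marg_df_marg_df[OF assms(1-3)] by (auto simp: unit_frechet_margins_def)

text \<open>Continuity from below as the other coordinates tend to infinity. It recovers marginals
  from pointwise values of \<open>F\<close>, which is how marginals of a power of a df become
  accessible.\<close>

lemma marg_df_LIMSEQ:
  assumes fin: "finite I" and F: "is_df I F" and T: "T \<subseteq> I"
  shows "(\<lambda>m. F (\<lambda>i. if i \<in> T then y i else real m)) \<longlonglongrightarrow> marg_df I F T y"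
proof -
  interpret prob_space "df_measure I F" by (rule prob_space_df_measure[OF F])
  let ?A = "\<lambda>m. {z\<in>space (df_measure I F). \<forall>i\<in>I. z i \<le> (if i \<in> T then y i else real m)}"
  have "range ?A \<subseteq> events"
    by (intro image_subsetI sets_orthant[OF fin order_refl sets_df_measure[OF F]])
  moreover have "incseq ?A"
    by (rule incseq_SucI) (fastforce intro: order_trans)
  ultimately have "(\<lambda>m. prob (?A m)) \<longlonglongrightarrow> prob (\<Union>m. ?A m)"
    by (rule finite_Lim_measure_incseq)
  also have "(\<Union>m. ?A m) = {z\<in>space (df_measure I F). \<forall>i\<in>T. z i \<le> y i}"
  proof -
    have "\<exists>m. \<forall>i\<in>I. z i \<le> real m" for z :: "nat \<Rightarrow> real"
    proof -
      obtain n where n: "Max (insert 0 (z ` I)) \<le> real n" using real_arch_simple by blast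
      have "z i \<le> real n" if "i \<in> I" for i
        using n Max_ge[of "insert 0 (z ` I)" "z i"] fin that by auto
      then show ?thesis by blast
    qed
    then show ?thesis using T by auto blast
  qed
  finally show ?thesis
    by (simp add: marg_df_eq[OF F T] df_eq_measure[OF F, symmetric])
qed

text \<open>The value of the df along \<open>X\<close> is the mass of the section at w of a jointly
  measurable set; no semicontinuity argument enters.\<close>

lemma borel_measurable_df:
  assumes fin: "finite I" and F: "is_df I F"
    and X[measurable]: "\<And>i. i \<in> I \<Longrightarrow> (\<lambda>w. X w i) \<in> borel_measurable N"
  shows "(\<lambda>w. F (X w)) \<in> borel_measurable N"
proof -
  interpret prob_space "df_measure I F" by (rule prob_space_df_measure[OF F])
  define D where "D = {p \<in> space (N \<Otimes>\<^sub>M df_measure I F). \<forall>i\<in>I. snd p i \<le> X (fst p) i}"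
  have [measurable]: "(\<lambda>z. z i) \<in> borel_measurable (df_measure I F)" if "i \<in> I" for i
    by (rule df_measurable[OF F that])
  have D: "D \<in> sets (N \<Otimes>\<^sub>M df_measure I F)"
    unfolding D_def using fin by measurable
  have "(\<lambda>w. measure (df_measure I F) (Pair w -` D)) \<in> borel_measurable N"
    using measurable_emeasure_Pair[OF D] unfolding measure_def by measurable
  then show ?thesis
    by (rule measurable_cong[THEN iffD1, rotated])
      (auto simp: D_def space_pair_measure df_eq_measure[OF F] intro!: arg_cong[where f="measure _"])
qed

section \<open>Max-id distribution functions with unit Frechet margins\<close>

text \<open>The atom at t lies in the slab s < X \<le> t, whose mass v s - v t tends to 0 as s
  increases to t. Only upper tails occur, so the argument also serves measures of infinite total
  mass.\<close>

lemma emeasure_atom_eq_0: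
  fixes X :: "'a \<Rightarrow> real"
  assumes X[measurable]: "X \<in> borel_measurable N"
    and v: "\<And>s. 0 < s \<Longrightarrow> emeasure N {w\<in>space N. s < X w} = ennreal (v s)" "\<And>s. 0 < s \<Longrightarrow> 0 \<le> v s"
    and cont: "isCont v t" and t: "0 < t"
  shows "emeasure N {w\<in>space N. X w = t} = 0"
proof -
  \<comment> \<open>The offset 2 gives s_0 = t/2, so every s_n is positive and the tail above it is
    finite.\<close>
  define s where "s n = t - t / real (n + 2)" for n
  have s: "0 < s n" "s n < t" for n
    using t by (auto simp: s_def field_simps intro: add_pos_nonneg)
  have "s \<longlonglongrightarrow> t" unfolding s_def using t by real_asymp
  then have "(\<lambda>n. v (s n)) \<longlonglongrightarrow> v t" by (rule isCont_tendsto_compose[OF cont])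
  then have "(\<lambda>n. v (s n) - v t) \<longlonglongrightarrow> 0" by (auto intro: LIM_zero)
  then have lim: "(\<lambda>n. ennreal (v (s n) - v t)) \<longlonglongrightarrow> ennreal 0" by (intro tendsto_ennrealI)
  have "emeasure N {w\<in>space N. X w = t} \<le> ennreal (v (s n) - v t)" for n
  proof -
    have "emeasure N {w\<in>space N. X w = t} \<le> emeasure N ({w\<in>space N. s n < X w} - {w\<in>space N. t < X w})"
      using s by (intro emeasure_mono) auto
    also have "\<dots> = emeasure N {w\<in>space N. s n < X w} - emeasure N {w\<in>space N. t < X w}"
      using v[OF t] s(2)[of n] by (intro emeasure_Diff) auto
    also have "\<dots> = ennreal (v (s n) - v t)"
      using v s t by (simp add: ennreal_minus)
    finally show ?thesis .
  qed
  then have "emeasure N {w\<in>space N. X w = t} \<le> ennreal 0"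
    by (intro LIMSEQ_le_const[OF lim]) auto
  then show ?thesis by simp
qed

locale frechet_df =
  fixes I :: "nat set" and F :: "(nat \<Rightarrow> real) \<Rightarrow> real"
  assumes finite_index: "finite I" and index_nonempty: "I \<noteq> {}"
    and df: "is_df I F" and margins: "unit_frechet_margins I F"
begin

sublocale prob_space "df_measure I F" by (rule prob_space_df_measure[OF df])

lemma coord_measurable[measurable]: "i \<in> I \<Longrightarrow> (\<lambda>z. z i) \<in> borel_measurable (df_measure I F)"
  by (rule df_measurable[OF df])

lemma prob_margin: "i \<in> I \<Longrightarrow> prob {z\<in>space (df_measure I F). z i \<le> t} = frechet t"
  using margins marg_df_eq[OF df, of "{i}" "\<lambda>_. t"] by (simp add: unit_frechet_margins_def)

lemma AE_pos: "AE z in df_measure I F. \<forall>i\<in>I. 0 < z i"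
proof (rule AE_finite_allI[OF finite_index])
  fix i assume i: "i \<in> I"
  then have "AE z in df_measure I F. \<not> z i \<le> 0"
    using prob_margin[OF i, of 0]
    by (intro AE_I[where N="{z\<in>space (df_measure I F). z i \<le> 0}"])
      (auto simp: frechet_def emeasure_eq_measure)
  then show "AE z in df_measure I F. 0 < z i" by (simp add: not_le)
qed

lemma frechet_df_marg_df: "T \<subseteq> I \<Longrightarrow> T \<noteq> {} \<Longrightarrow> frechet_df T (marg_df I F T)"
  using finite_index df margins finite_subset[of T I]
  by unfold_locales (auto intro: is_df_marg_df unit_frechet_margins_marg_df)

text \<open>Up to the null atom at 1/a, P(1/z_i \<le> a) = P(z_i > 1/a) = 1 - exp(-a): the inverse
  of a unit Frechet variable is standard exponential.\<close>

lemma has_expectation_inverse: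
  assumes i: "i \<in> I"
  shows "integrable (df_measure I F) (\<lambda>z. 1 / z i)" and "expectation (\<lambda>z. 1 / z i) = 1"
proof -
  let ?M = "df_measure I F"
  have gt: "emeasure ?M {z\<in>space ?M. s < z i} = ennreal (1 - frechet s)" for s
  proof -
    have "prob {z\<in>space ?M. s < z i} = 1 - prob {z\<in>space ?M. z i \<le> s}"
      using i by (subst prob_neg[symmetric]) (auto simp: not_le)
    then show ?thesis using prob_margin[OF i] by (simp add: emeasure_eq_measure)
  qed
  have atom: "emeasure ?M {z\<in>space ?M. z i = t} = 0" if "0 < t" for t
  proof (rule emeasure_atom_eq_0[where v="\<lambda>s. 1 - exp (- 1 / s)"])
    show "emeasure ?M {z\<in>space ?M. s < z i} = ennreal (1 - exp (- 1 / s))" if "0 < s" for s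
      using gt[of s] that by (simp add: frechet_def)
    show "isCont (\<lambda>s. 1 - exp (- 1 / s)) t" using that by (intro continuous_intros) auto
  qed (use i that in auto)
  have "emeasure ?M {z\<in>space ?M. 1 / z i \<le> a} = 1 - exp (- a * 1)" if a: "0 \<le> a" for a
  proof (cases "a = 0")
    case True
    have "emeasure ?M {z\<in>space ?M. 1 / z i \<le> a} = emeasure ?M {}"
      by (rule emeasure_eq_AE) (use AE_pos i True in \<open>auto elim!: eventually_mono\<close>)
    then show ?thesis using True by simp
  next
    case False
    have "AE z in ?M. z i \<noteq> 1 / a"
      by (rule AE_I[where N="{z\<in>space ?M. z i = 1 / a}"]) (use atom[of "1 / a"] a False i in auto)
    then have "AE z in ?M. z \<in> {z\<in>space ?M. 1 / z i \<le> a} \<longleftrightarrow> z \<in> {z\<in>space ?M. 1 / a < z i}"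
      using AE_pos by eventually_elim (use a False i in \<open>auto simp: field_simps less_le\<close>)
    then have "emeasure ?M {z\<in>space ?M. 1 / z i \<le> a} = emeasure ?M {z\<in>space ?M. 1 / a < z i}"
      by (rule emeasure_eq_AE) (use i in auto)
    then show ?thesis using gt[of "1 / a"] a False by (simp add: frechet_def)
  qed
  then have "distributed ?M lborel (\<lambda>z. 1 / z i) (exponential_density 1)"
    using i by (intro exponential_distributedI) (auto simp: ennreal_minus simp flip: ennreal_1)
  then show e: "expectation (\<lambda>z. 1 / z i) = 1"
    using exponential_distributed_expectation[of 1 "\<lambda>z. 1 / z i"] by simp
  \<comment> \<open>A non-integrable function has Bochner integral 0 by convention, so the value 1
    forces integrability.\<close>
  then show "integrable ?M (\<lambda>z. 1 / z i)"
    using not_integrable_integral_eq[of ?M "\<lambda>z. 1 / z i"] by (metis zero_neq_one)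
qed

lemma le_frechet: "i \<in> I \<Longrightarrow> F x \<le> frechet (x i)"
  unfolding df_eq_measure[OF df, of x] prob_margin[symmetric]
  by (rule finite_measure_mono) auto

end

text \<open>Change of variables along the restriction map, which then disappears because
  \<open>G\<close> ignores coordinates outside \<open>T\<close>. All mu-terms of marginals thereby
  become integrals under the single law of \<open>Q\<close>.\<close>

lemma integral_marg_df:
  assumes fin: "finite I" and Q: "is_df I Q" and T: "T \<subseteq> I" and G: "is_df T G"
    and f: "(f :: real \<Rightarrow> real) \<in> borel_measurable borel"
  shows "(\<integral>z. f (G z) \<partial>df_measure T (marg_df I Q T)) = (\<integral>z. f (G z) \<partial>df_measure I Q)"
proof -
  have fT: "finite T" using fin T finite_subset by auto
  have r: "(\<lambda>x. restrict x T) \<in> measurable (df_measure I Q) (PiM T (\<lambda>_. borel :: real measure))"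
    using measurable_restrict_subset[OF T] by (simp add: sets_df_measure[OF Q] cong: measurable_cong_sets)
  have "(\<lambda>z. G z) \<in> borel_measurable (PiM T (\<lambda>_. borel))"
    by (rule borel_measurable_df[OF fT G]) auto
  then have "(\<lambda>z. f (G z)) \<in> borel_measurable (PiM T (\<lambda>_. borel))"
    using f by measurable
  then have "(\<integral>z. f (G z) \<partial>df_measure T (marg_df I Q T)) = (\<integral>z. f (G (restrict z T)) \<partial>df_measure I Q)"
    unfolding df_measure_marg_df[OF fin Q T] by (rule integral_distr[OF r, of "\<lambda>z. f (G z)"])
  also have "(\<lambda>z. f (G (restrict z T))) = (\<lambda>z. f (G z))"
    by (intro ext arg_cong[where f=f] df_cong[OF G]) auto
  finally show ?thesis .
qed

locale max_id_frechet = frechet_df I H for I H +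
  assumes max_id: "max_id I H"
begin

lemma df_powr: "0 < t \<Longrightarrow> is_df I (\<lambda>x. H x powr t)"
  using max_id by (simp add: max_id_def)

text \<open>Powers and marginals commute because a marginal is a limit of values of the df and a
  positive power is continuous on the nonnegative reals, including 0.\<close>

lemma marg_df_powr:
  assumes t: "0 < t" and T: "T \<subseteq> I"
  shows "marg_df I (\<lambda>x. H x powr t) T y = marg_df I H T y powr t"
proof (rule LIMSEQ_unique[OF marg_df_LIMSEQ[OF finite_index df_powr[OF t] T]])
  show "(\<lambda>m. H (\<lambda>i. if i \<in> T then y i else real m) powr t) \<longlonglongrightarrow> marg_df I H T y powr t"
    using marg_df_LIMSEQ[OF finite_index df T] t df_nonneg[OF df] by (intro tendsto_powr') auto
qed

lemma max_id_frechet_marg_df: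
  assumes T: "T \<subseteq> I" "T \<noteq> {}"
  shows "max_id_frechet T (marg_df I H T)"
proof -
  interpret T: frechet_df T "marg_df I H T" by (rule frechet_df_marg_df[OF T])
  have "is_df T (\<lambda>x. marg_df I H T x powr t)" if "0 < t" for t
  proof -
    have "marg_df I (\<lambda>x. H x powr t) T = (\<lambda>x. marg_df I H T x powr t)"
      by (rule ext) (rule marg_df_powr[OF that T(1)])
    then show ?thesis
      using is_df_marg_df[OF finite_index df_powr[OF that] T(1)] by simp
  qed
  then show ?thesis
    by unfold_locales (auto simp: max_id_def T.df)
qed

text \<open>Union bound under the distribution with df H to the power s.\<close>
lemma one_minus_powr_le:
  assumes z: "\<And>i. i \<in> I \<Longrightarrow> 0 < z i" and s: "0 < s"
  shows "1 - H z powr s \<le> s * (\<Sum>i\<in>I. 1 / z i)"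
proof -
  let ?M = "df_measure I (\<lambda>x. H x powr s)"
  interpret M: prob_space ?M by (rule prob_space_df_measure[OF df_powr[OF s]])
  have [measurable]: "(\<lambda>z. z i) \<in> borel_measurable ?M" if "i \<in> I" for i
    by (rule df_measurable[OF df_powr[OF s] that])
  have "1 - H z powr s = M.prob {x\<in>space ?M. \<not> (\<forall>i\<in>I. x i \<le> z i)}"
    using finite_index df_eq_measure[OF df_powr[OF s], of z] by (subst M.prob_neg) auto
  also have "{x\<in>space ?M. \<not> (\<forall>i\<in>I. x i \<le> z i)} = (\<Union>i\<in>I. {x\<in>space ?M. \<not> x i \<le> z i})" by auto
  also have "M.prob \<dots> \<le> (\<Sum>i\<in>I. M.prob {x\<in>space ?M. \<not> x i \<le> z i})"
    using finite_index by (intro M.finite_measure_subadditive_finite) auto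
  also have "\<dots> \<le> (\<Sum>i\<in>I. s * (1 / z i))"
  proof (rule sum_mono)
    fix i assume i: "i \<in> I"
    have "M.prob {x\<in>space ?M. x i \<le> z i} = frechet (z i) powr s"
      using marg_df_eq[OF df_powr[OF s], of "{i}" z] marg_df_powr[OF s, of "{i}" z] i
        marg_df_eq[OF df, of "{i}" z] prob_margin[OF i] by simp
    also have "\<dots> = exp (- (s * (1 / z i)))"
      using z[OF i] by (simp add: frechet_def powr_def)
    finally have "M.prob {x\<in>space ?M. \<not> x i \<le> z i} = 1 - exp (- (s * (1 / z i)))"
      using i by (subst M.prob_neg) auto
    also have "\<dots> \<le> s * (1 / z i)"
      using exp_ge_add_one_self[of "- (s * (1 / z i))"] by linarith
    finally show "M.prob {x\<in>space ?M. \<not> x i \<le> z i} \<le> s * (1 / z i)" .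
  qed
  finally show ?thesis by (simp add: sum_distrib_left)
qed

text \<open>A zero of \<open>H\<close> would persist in every power, whereas the bound of
  \<open>one_minus_powr_le\<close> is proportional to the exponent; the exponent 1/(c+1) makes that
  bound smaller than 1.\<close>

lemma pos:
  assumes z: "\<And>i. i \<in> I \<Longrightarrow> 0 < z i"
  shows "0 < H z"
proof (rule ccontr)
  assume "\<not> 0 < H z"
  then have H: "H z = 0" using df_nonneg[OF df, of z] by simp
  define c where "c = (\<Sum>i\<in>I. 1 / z i)"
  have c: "0 \<le> c" unfolding c_def using z by (intro sum_nonneg) (auto intro: less_imp_le)
  have "1 \<le> 1 / (c + 1) * c"
    using one_minus_powr_le[of z "1 / (c + 1)"] z c H by (simp add: c_def)
  then show False using c by (simp add: field_simps)
qed

lemma scaled_one_minus_powr_LIMSEQ: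
  assumes z: "\<And>i. i \<in> I \<Longrightarrow> 0 < z i"
  shows "(\<lambda>n. real n * (1 - H z powr (1 / real n))) \<longlonglongrightarrow> - ln (H z)"
proof -
  have "(\<lambda>n. real n * (1 - exp (c / real n))) \<longlonglongrightarrow> - c" for c
    by real_asymp
  from this[of "ln (H z)"] show ?thesis
    using pos[of z] z by (simp add: powr_def)
qed

text \<open>The upper bound is \<open>one_minus_powr_le\<close> at exponent 1/n, multiplied by n, in
  the limit. It provides the integrable majorant of -ln H.\<close>

lemma minus_ln_bounds:
  assumes z: "\<And>i. i \<in> I \<Longrightarrow> 0 < z i"
  shows "0 \<le> - ln (H z)" and "- ln (H z) \<le> (\<Sum>i\<in>I. 1 / z i)"
proof -
  show "0 \<le> - ln (H z)" using pos[OF z] df_le_1[OF df, of z] by (simp add: ln_le_zero_iff)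
  show "- ln (H z) \<le> (\<Sum>i\<in>I. 1 / z i)"
  proof (rule LIMSEQ_le_const2[OF scaled_one_minus_powr_LIMSEQ[OF z]], assumption, intro exI[of _ 1] allI impI)
    fix n :: nat assume n: "1 \<le> n"
    have "real n * (1 - H z powr (1 / real n)) \<le> real n * (1 / real n * (\<Sum>i\<in>I. 1 / z i))"
      using z n by (intro mult_left_mono one_minus_powr_le) auto
    then show "real n * (1 - H z powr (1 / real n)) \<le> (\<Sum>i\<in>I. 1 / z i)" using n by simp
  qed
qed

end

section \<open>Existence of the exponent measure\<close>

text \<open>Kolmogorov extension applied to the limits of the joint laws of the indicators of the events.
  It replaces a vague compactness argument, which the library has in dimension one only.\<close>
lemma limit_events_exist:
  fixes R :: "nat \<Rightarrow> 'a measure" and J :: "'j set" and A :: "'j \<Rightarrow> 'a set" and p :: "'j set \<Rightarrow> real"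
  assumes R: "\<And>n. prob_space (R n)" and A: "\<And>n j. j \<in> J \<Longrightarrow> A j \<in> sets (R n)"
    and conv: "\<And>S. \<lbrakk>finite S; S \<subseteq> J\<rbrakk> \<Longrightarrow>
      (\<lambda>n. measure (R n) {x\<in>space (R n). \<forall>j\<in>S. x \<in> A j}) \<longlonglongrightarrow> p S"
  shows "\<exists>(L :: ('j \<Rightarrow> real) measure) B. prob_space L \<and> (\<forall>j\<in>J. B j \<in> sets L) \<and>
    (\<forall>S. finite S \<longrightarrow> S \<subseteq> J \<longrightarrow> measure L {x\<in>space L. \<forall>j\<in>S. x \<in> B j} = p S)"
proof -
  \<comment> \<open>Convergence is given for intersections of events only. Removing the negated
    events one at a time, as differences, extends it to all atoms of the finite algebras they
    generate.\<close>
  have conv2: "convergent (\<lambda>n. measure (R n) {x\<in>space (R n). (\<forall>j\<in>S. x \<in> A j) \<and> (\<forall>j\<in>T. x \<notin> A j)})"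
    if "finite T" "T \<subseteq> J" "finite S" "S \<subseteq> J" for S T
    using that
  proof (induction T arbitrary: S)
    case empty
    then show ?case using conv[of S] by (auto simp: convergent_def)
  next
    case (insert t T)
    let ?E = "\<lambda>S T n. {x\<in>space (R n). (\<forall>j\<in>S. x \<in> A j) \<and> (\<forall>j\<in>T. x \<notin> A j)}"
    have "measure (R n) (?E S (insert t T) n) = measure (R n) (?E S T n) - measure (R n) (?E (insert t S) T n)" for n
    proof -
      interpret prob_space "R n" by (rule R)
      have meas: "?E S' T' n \<in> sets (R n)" if "finite T'" "T' \<subseteq> J" "finite S'" "S' \<subseteq> J" for S' T'
        using A[of _ n] that by (auto intro!: sets.sets_Collect sets.sets_Collect_finite_All  simp: subset_eq pred_def)
      have "?E S (insert t T) n = ?E S T n - ?E (insert t S) T n" by auto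
      moreover have "?E (insert t S) T n \<subseteq> ?E S T n" by auto
      ultimately show ?thesis
        using insert.prems insert.hyps meas[of T S] meas[of T "insert t S"]
        by (simp add: finite_measure_Diff)
    qed
    then show ?case
      using insert.IH[of S] insert.IH[of "insert t S"] insert.prems by (simp add: convergent_diff)
  qed
  \<comment> \<open>\<open>vec K x\<close> is the 0-1 pattern of x relative to the events in K,
    \<open>ind K U\<close> the pattern with support U, and \<open>E K U n\<close> the event that
    this pattern occurs. \<open>P K\<close> gives each pattern its limiting probability
    \<open>w K U\<close>; patterns are coded as real vectors so that Kolmogorov extension over a
    Polish space applies.\<close>
  define vec where "vec K x = (\<lambda>j\<in>K. indicator (A j) x :: real)" for K x
  define ind where "ind K U = (\<lambda>j\<in>K. indicator U j :: real)" for K and U :: "'j set"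
  define E where "E K U n = {x\<in>space (R n). \<forall>j\<in>K. x \<in> A j \<longleftrightarrow> j \<in> U}" for K U n
  define w where "w K U = lim (\<lambda>n. measure (R n) (E K U n))" for K U
  define P where "P K = distr (point_measure (Pow K) (w K)) (PiM K (\<lambda>_. borel)) (ind K)" for K
  have E[measurable]: "E K U n \<in> sets (R n)" if "finite K" "K \<subseteq> J" for K U n
  proof -
    have "{x\<in>space (R n). x \<in> A j \<longleftrightarrow> j \<in> U} \<in> sets (R n)" if "j \<in> K" for j
      using A[of j n] that \<open>K \<subseteq> J\<close> by (cases "j \<in> U") auto
    then show ?thesis unfolding E_def
      using that by (intro sets.sets_Collect_finite_All) auto
  qed
  have w: "(\<lambda>n. measure (R n) (E K U n)) \<longlonglongrightarrow> w K U" if "finite K" "K \<subseteq> J" "U \<subseteq> K" for K U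
  proof -
    have "E K U n = {x\<in>space (R n). (\<forall>j\<in>U. x \<in> A j) \<and> (\<forall>j\<in>K-U. x \<notin> A j)}" for n
      using that by (auto simp: E_def)
    moreover have "finite (K - U)" "K - U \<subseteq> J" "finite U" "U \<subseteq> J"
      using that finite_subset by auto
    ultimately show ?thesis
      using conv2[of "K - U" U] unfolding w_def by (simp add: convergent_LIMSEQ_iff)
  qed
  have w0: "0 \<le> w K U" if "finite K" "K \<subseteq> J" "U \<subseteq> K" for K U
    by (rule LIMSEQ_le_const[OF w[OF that]]) auto
  have vec_eq: "measure (R n) {x\<in>space (R n). vec K x \<in> X} = (\<Sum>U | U \<subseteq> K \<and> ind K U \<in> X. measure (R n) (E K U n))"
    if K: "finite K" "K \<subseteq> J" for K X n
  proof -
    interpret prob_space "R n" by (rule R)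
    have "{x\<in>space (R n). vec K x \<in> X} = (\<Union>U\<in>{U. U \<subseteq> K \<and> ind K U \<in> X}. E K U n)"
    proof (intro set_eqI iffI)
      fix x assume x: "x \<in> {x\<in>space (R n). vec K x \<in> X}"
      have "vec K x = ind K {j\<in>K. x \<in> A j}"
        by (auto simp: vec_def ind_def indicator_def)
      then show "x \<in> (\<Union>U\<in>{U. U \<subseteq> K \<and> ind K U \<in> X}. E K U n)"
        using x by (intro UN_I[of "{j\<in>K. x \<in> A j}"]) (auto simp: E_def)
    next
      fix x assume "x \<in> (\<Union>U\<in>{U. U \<subseteq> K \<and> ind K U \<in> X}. E K U n)"
      then obtain U where U: "ind K U \<in> X" "x \<in> E K U n" by blast
      then have "vec K x = ind K U"
        by (auto simp: vec_def ind_def indicator_def E_def)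
      then show "x \<in> {x\<in>space (R n). vec K x \<in> X}"
        using U by (simp add: E_def)
    qed
    moreover have "disjoint_family_on (\<lambda>U. E K U n) {U. U \<subseteq> K \<and> ind K U \<in> X}"
      by (auto simp: disjoint_family_on_def E_def)
    ultimately show ?thesis
      using K by (auto intro!: finite_measure_finite_Union)
  qed
  have sum_w: "(\<lambda>n. measure (R n) {x\<in>space (R n). vec K x \<in> X}) \<longlonglongrightarrow> (\<Sum>U | U \<subseteq> K \<and> ind K U \<in> X. w K U)"
    if K: "finite K" "K \<subseteq> J" for K X
    unfolding vec_eq[OF K] using K by (intro tendsto_sum w) auto
  have prob_pm: "prob_space (point_measure (Pow K) (w K))" if K: "finite K" "K \<subseteq> J" for K
  proof (rule prob_space_point_measure)
    \<comment> \<open>There are finitely many patterns, so the limits of their probabilities still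
      add up to 1.\<close>
    have "(\<lambda>n. 1) \<longlonglongrightarrow> (\<Sum>U | U \<subseteq> K \<and> ind K U \<in> UNIV. w K U)"
      using sum_w[OF K, of UNIV] R by (simp add: prob_space.prob_space)
    then have "1 = (\<Sum>U | U \<subseteq> K. w K U)"
      by (simp add: LIMSEQ_const_iff)
    then show "(\<Sum>U\<in>Pow K. ennreal (w K U)) = 1"
      using K w0 by (subst sum_ennreal) (auto simp: Pow_def)
  qed (use K w0 in auto)
  have ind_meas: "ind K \<in> measurable (point_measure (Pow K) (w K)) (PiM K (\<lambda>_. borel))" for K
    by (auto simp: measurable_point_measure_eq1 space_PiM ind_def)
  have P: "measure (P K) X = (\<Sum>U | U \<subseteq> K \<and> ind K U \<in> X. w K U)"
    if K: "finite K" "K \<subseteq> J" and X: "X \<in> sets (PiM K (\<lambda>_. borel))" for K X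
  proof -
    have "measure (P K) X = measure (point_measure (Pow K) (w K)) (ind K -` X \<inter> Pow K)"
      unfolding P_def by (subst measure_distr[OF ind_meas X]) (simp add: space_point_measure)
    also have "\<dots> = (\<Sum>U\<in>ind K -` X \<inter> Pow K. w K U)"
      using K w0 by (subst measure_point_measure_finite_if) auto
    also have "ind K -` X \<inter> Pow K = {U. U \<subseteq> K \<and> ind K U \<in> X}" by auto
    finally show ?thesis .
  qed
  have prob_P: "prob_space (P K)" if "finite K" "K \<subseteq> J" for K
    unfolding P_def by (rule prob_space.prob_space_distr[OF prob_pm[OF that] ind_meas])
  have lim_P: "(\<lambda>n. measure (R n) {x\<in>space (R n). vec K x \<in> X}) \<longlonglongrightarrow> measure (P K) X"
    if K: "finite K" "K \<subseteq> J" "X \<in> sets (PiM K (\<lambda>_. borel))" for K X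
    using sum_w[OF K(1,2)] P[OF K] by simp
  \<comment> \<open>Consistency: the pattern over the smaller index set is the restriction of the
    pattern over the larger one, so both measures of a set are limits of the same sequence of
    \<open>R n\<close>-probabilities.\<close>
  interpret L: polish_projective J P
  proof (intro polish_projective.intro projective_family.intro)
    fix K H assume K: "K \<subseteq> H" "finite H" "H \<subseteq> J"
    have fK: "finite K" "K \<subseteq> J" using K finite_subset by auto
    have sets_P: "sets (P K) = sets (PiM K (\<lambda>_. borel))" for K by (simp add: P_def)
    have restr: "(\<lambda>f. restrict f K) \<in> measurable (P H) (PiM K (\<lambda>_. borel))"
      using measurable_restrict_subset[OF K(1)] sets_P[of H] by (simp cong: measurable_cong_sets)
    show "P K = distr (P H) (PiM K (\<lambda>_. borel)) (\<lambda>f. restrict f K)"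
    proof (rule measure_eqI)
      fix X assume "X \<in> sets (P K)"
      then have X: "X \<in> sets (PiM K (\<lambda>_. borel))" by (simp add: sets_P)
      interpret PK: prob_space "P K" by (rule prob_P[OF fK])
      interpret PH: prob_space "distr (P H) (PiM K (\<lambda>_. borel)) (\<lambda>f. restrict f K)"
        by (rule prob_space.prob_space_distr[OF prob_P restr]) (use K in auto)
      have Y: "(\<lambda>f. restrict f K) -` X \<inter> space (P H) \<in> sets (PiM H (\<lambda>_. borel))"
        using measurable_sets[OF restr X] by (simp add: sets_P)
      have sH: "vec H x \<in> space (P H)" "restrict (vec H x) K = vec K x" for x
        using K by (auto simp: sets_eq_imp_space_eq[OF sets_P] space_PiM vec_def fun_eq_iff restrict_def)
      have "measure (distr (P H) (PiM K (\<lambda>_. borel)) (\<lambda>f. restrict f K)) X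
          = measure (P H) ((\<lambda>f. restrict f K) -` X \<inter> space (P H))"
        by (rule measure_distr[OF restr X])
      moreover have "(\<lambda>n. measure (R n) {x\<in>space (R n). vec K x \<in> X})
          \<longlonglongrightarrow> measure (P H) ((\<lambda>f. restrict f K) -` X \<inter> space (P H))"
        using lim_P[OF K(2,3) Y] sH by simp
      ultimately have "measure (P K) X = measure (distr (P H) (PiM K (\<lambda>_. borel)) (\<lambda>f. restrict f K)) X"
        using LIMSEQ_unique[OF lim_P[OF fK X]] by simp
      then show "emeasure (P K) X = emeasure (distr (P H) (PiM K (\<lambda>_. borel)) (\<lambda>f. restrict f K)) X"
        by (simp add: PK.emeasure_eq_measure PH.emeasure_eq_measure)
    qed (simp add: sets_P)
  qed (rule prob_P)
  \<comment> \<open>Coordinate j equal to 1 encodes that the j-th event occurs.\<close>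
  define B where "B j = {x\<in>space (PiM J (\<lambda>_. borel)). x j = (1::real)}" for j
  have meas1: "{x\<in>space (PiM S (\<lambda>_. borel)). \<forall>j\<in>S. x j = (1::real)} \<in> sets (PiM S (\<lambda>_. borel))" if "finite S" for S :: "'j set"
    using that by (intro sets.sets_Collect_finite_All) measurable
  show ?thesis
  proof (intro exI[of _ L.lim] exI[of _ B] conjI allI impI ballI)
    show "prob_space L.lim" by unfold_locales
    fix S assume S: "finite S" "S \<subseteq> J"
    let ?X = "{x\<in>space (PiM S (\<lambda>_. borel)). \<forall>j\<in>S. x j = (1::real)}"
    have "measure L.lim (prod_emb J (\<lambda>_. borel) S ?X) = measure (P S) ?X"
      using L.emeasure_lim_emb[OF S(2,1) meas1[OF S(1)]] by (simp add: measure_def)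
    moreover have "prod_emb J (\<lambda>_. borel) S ?X = {x\<in>space L.lim. \<forall>j\<in>S. x \<in> B j}"
      using S by (auto simp: prod_emb_def B_def space_PiM)
    moreover have "measure (P S) ?X = p S"
    proof (rule LIMSEQ_unique[OF lim_P[OF S meas1[OF S(1)]]])
      have "{x\<in>space (R n). vec S x \<in> ?X} = {x\<in>space (R n). \<forall>j\<in>S. x \<in> A j}" for n
        by (auto simp: vec_def space_PiM indicator_def split: if_splits)
      then show "(\<lambda>n. measure (R n) {x\<in>space (R n). vec S x \<in> ?X}) \<longlonglongrightarrow> p S"
        using conv[OF S] by simp
    qed
    ultimately show "measure L.lim {x\<in>space L.lim. \<forall>j\<in>S. x \<in> B j} = p S" by simp
  qed (simp add: B_def)
qed

text \<open>The events \<open>B q\<close> play the role of {X \<le> q}; X is recovered as the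
  infimum of the rational levels q whose event occurs. The chain need not be right-continuous, hence
  the characterisation by all levels slightly above y. Monotonicity holds only almost surely for
  each pair of levels, so the exceptional null set depends on y.\<close>

lemma random_variable_of_chain:
  fixes B :: "real \<Rightarrow> 'a set"
  assumes B: "\<And>q. 0 < q \<Longrightarrow> B q \<in> sets L"
    and mono: "\<And>q q'. \<lbrakk>0 < q; q \<le> q'\<rbrakk> \<Longrightarrow> AE \<omega> in L. \<omega> \<in> B q \<longrightarrow> \<omega> \<in> B q'"
  shows "\<exists>X :: 'a \<Rightarrow> ereal. X \<in> borel_measurable L \<and> (\<forall>\<omega>. 0 \<le> X \<omega>) \<and>
    (\<forall>y>0. AE \<omega> in L. X \<omega> \<le> ereal y \<longleftrightarrow> (\<forall>k::nat. \<omega> \<in> B (y + 1 / real (Suc k))))"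
proof -
  let ?Q = "\<rat> \<inter> {0<..} :: real set"
  define X where "X \<omega> = (INF q\<in>?Q. if \<omega> \<in> B q then ereal q else \<infinity>)" for \<omega>
  have count: "countable ?Q" using countable_rat by (rule countable_subset[rotated]) auto
  have X: "X \<in> borel_measurable L"
    unfolding X_def
  proof (rule borel_measurable_INF[OF count])
    fix q assume "q \<in> ?Q"
    then have [measurable]: "B q \<in> sets L" using B by auto
    show "(\<lambda>\<omega>. if \<omega> \<in> B q then ereal q else \<infinity>) \<in> borel_measurable L" by measurable
  qed
  have X0: "0 \<le> X \<omega>" for \<omega>
    unfolding X_def by (rule INF_greatest) auto
  have "AE \<omega> in L. X \<omega> \<le> ereal y \<longleftrightarrow> (\<forall>k::nat. \<omega> \<in> B (y + 1 / real (Suc k)))" if y: "0 < y" for y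
  proof -
  let ?y = "\<lambda>k. y + 1 / real (Suc k)"
  have ypos: "0 < ?y k" for k using y by (simp add: add_pos_pos)
  \<comment> \<open>For fixed y only countably many pairs of levels are compared: the rationals
    against the sequence \<open>?y\<close>.\<close>
  have "AE \<omega> in L. \<forall>q\<in>?Q. \<forall>k. (q \<le> ?y k \<longrightarrow> \<omega> \<in> B q \<longrightarrow> \<omega> \<in> B (?y k)) \<and> (?y k \<le> q \<longrightarrow> \<omega> \<in> B (?y k) \<longrightarrow> \<omega> \<in> B q)"
    using mono ypos by (subst AE_ball_countable[OF count]) (auto simp: AE_all_countable)
  then show ?thesis
  proof eventually_elim
    fix \<omega>
    assume *: "\<forall>q\<in>?Q. \<forall>k. (q \<le> ?y k \<longrightarrow> \<omega> \<in> B q \<longrightarrow> \<omega> \<in> B (?y k)) \<and> (?y k \<le> q \<longrightarrow> \<omega> \<in> B (?y k) \<longrightarrow> \<omega> \<in> B q)"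
    show "X \<omega> \<le> ereal y \<longleftrightarrow> (\<forall>k::nat. \<omega> \<in> B (?y k))"
    proof (intro iffI allI)
      fix k assume "X \<omega> \<le> ereal y"
      also have "ereal y < ereal (?y k)" by simp
      finally obtain q where q: "q \<in> ?Q" "(if \<omega> \<in> B q then ereal q else \<infinity>) < ereal (?y k)"
        unfolding X_def INF_less_iff by blast
      then show "\<omega> \<in> B (?y k)"
        using * by (auto split: if_splits simp: less_imp_le)
    next
      assume B: "\<forall>k::nat. \<omega> \<in> B (?y k)"
      \<comment> \<open>The doubled margin leaves room for a rational strictly above
        \<open>?y k\<close>, since only rational levels enter the infimum.\<close>
      have "X \<omega> \<le> ereal (y + 2 / real (Suc k))" for k
      proof -
        have "?y k < y + 2 / real (Suc k)" by (simp add: divide_strict_right_mono)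
        then obtain q where q: "q \<in> \<rat>" "?y k < q" "q < y + 2 / real (Suc k)"
          using Rats_dense_in_real by blast
        then have qQ: "q \<in> ?Q" using ypos[of k] by auto
        then have "\<omega> \<in> B q" using * B q by (meson less_imp_le)
        then have "X \<omega> \<le> ereal q"
          unfolding X_def by (intro INF_lower2[OF qQ]) simp
        then show ?thesis using q by (meson ereal_less_eq(3) less_imp_le order_trans)
      qed
      moreover have "(\<lambda>k. ereal (y + 2 / real (Suc k))) \<longlonglongrightarrow> ereal y"
        unfolding lim_ereal by real_asymp
      ultimately show "X \<omega> \<le> ereal y"
        by (intro LIMSEQ_le_const[of "\<lambda>k. ereal (y + 2 / real (Suc k))"]) blast+
    qed
  qed
  qed
  with X X0 show ?thesis by blast
qed

section \<open>Cylinder events and their probabilities under powers of \<open>H\<close>\<close>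

context max_id_frechet
begin

text \<open>Constraints are pairs (coordinate, level), and several levels per coordinate are
  allowed. Intersections of events thus become unions of constraint sets, in the form that
  \<open>limit_events_exist\<close> expects.\<close>

definition cyl :: "(nat \<times> real) set \<Rightarrow> (nat \<Rightarrow> real) set" where
  "cyl S = {x\<in>space (PiM I (\<lambda>_. borel)). \<forall>j\<in>S. x (fst j) \<le> snd j}"

lemma cyl_sets:
  assumes "finite S" "fst ` S \<subseteq> I" "sets M = sets (PiM I (\<lambda>_. borel))"
  shows "cyl S \<in> sets M"
proof -
  have "(\<lambda>z. z (fst j)) \<in> borel_measurable (PiM I (\<lambda>_. borel :: real measure))" if "j \<in> S" for j
    using assms that by auto
  then show ?thesis
    unfolding cyl_def assms(3) using assms(1) by (intro sets.sets_Collect_finite_All) auto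
qed

lemma space_powr: "0 < s \<Longrightarrow> space (df_measure I (\<lambda>x. H x powr s)) = space (PiM I (\<lambda>_. borel))"
  by (rule space_df_measure[OF df_powr])

text \<open>For each coordinate only the smallest level counts. That it is itself a level of
  \<open>S\<close> transfers positivity of the levels to y.\<close>

lemma cyl_eq_orthant:
  assumes "finite S" "fst ` S \<subseteq> I"
  obtains y where "cyl S = {x\<in>space (PiM I (\<lambda>_. borel)). \<forall>i\<in>fst ` S. x i \<le> y i}"
    "\<And>i. i \<in> fst ` S \<Longrightarrow> (i, y i) \<in> S"
proof
  define y where "y i = Min {q. (i, q) \<in> S}" for i
  have fin: "finite {q. (i, q) \<in> S}" for i
    by (rule finite_subset[OF _ finite_imageI[OF assms(1), of snd]]) force
  show yS: "(i, y i) \<in> S" if "i \<in> fst ` S" for i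
    using Min_in[OF fin, of i] that by (fastforce simp: y_def)
  have "y i \<le> q" if "(i, q) \<in> S" for i q
    using Min_le[OF fin, of q i] that by (simp add: y_def)
  then have "(\<forall>j\<in>S. x (fst j) \<le> snd j) \<longleftrightarrow> (\<forall>i\<in>fst ` S. x i \<le> y i)" for x
    using yS by (metis (no_types, lifting) fst_conv image_eqI image_iff order_trans prod.collapse snd_conv)
  then show "cyl S = {x\<in>space (PiM I (\<lambda>_. borel)). \<forall>i\<in>fst ` S. x i \<le> y i}"
    unfolding cyl_def by blast
qed

lemma measure_cyl_powr:
  assumes S: "finite S" "fst ` S \<subseteq> I" and s: "0 < s"
  shows "measure (df_measure I (\<lambda>x. H x powr s)) (cyl S) = prob (cyl S) powr s"
proof -
  obtain y where y: "cyl S = {x\<in>space (PiM I (\<lambda>_. borel)). \<forall>i\<in>fst ` S. x i \<le> y i}"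
    "\<And>i. i \<in> fst ` S \<Longrightarrow> (i, y i) \<in> S"
    using cyl_eq_orthant[OF S] by blast
  have "measure (df_measure I (\<lambda>x. H x powr s)) (cyl S) = marg_df I (\<lambda>x. H x powr s) (fst ` S) y"
    unfolding marg_df_eq[OF df_powr[OF s] S(2)] y(1) space_powr[OF s] ..
  also have "\<dots> = marg_df I H (fst ` S) y powr s" by (rule marg_df_powr[OF s S(2)])
  also have "marg_df I H (fst ` S) y = prob (cyl S)"
    unfolding marg_df_eq[OF df S(2)] y(1) space_df_measure[OF df] ..
  finally show ?thesis .
qed

lemma prob_cyl_pos:
  assumes S: "finite S" "S \<subseteq> I \<times> {0<..}"
  shows "0 < prob (cyl S)"
proof -
  have SI: "fst ` S \<subseteq> I" using S by auto
  obtain y where y: "cyl S = {x\<in>space (PiM I (\<lambda>_. borel)). \<forall>i\<in>fst ` S. x i \<le> y i}"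
    "\<And>i. i \<in> fst ` S \<Longrightarrow> (i, y i) \<in> S"
    using cyl_eq_orthant[OF S(1) SI] by blast
  \<comment> \<open>Unconstrained coordinates receive the arbitrary positive level 1, giving a full
    orthant inside the cylinder.\<close>
  let ?z = "\<lambda>i. if i \<in> fst ` S then y i else 1"
  have "0 < H ?z" by (rule pos) (use y(2) S(2) in auto)
  also have "\<dots> \<le> prob (cyl S)"
    unfolding df_eq_measure[OF df, of ?z]
  proof (rule finite_measure_mono[OF _ cyl_sets[OF S(1) SI sets_df_measure[OF df]]])
    show "{x\<in>space (df_measure I H). \<forall>i\<in>I. x i \<le> ?z i} \<subseteq> cyl S"
      unfolding y(1) space_df_measure[OF df] using SI by (smt (verit) Collect_mono subsetD)
  qed
  finally show ?thesis .
qed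

lemma less_1:
  assumes "\<And>i. i \<in> I \<Longrightarrow> 0 < z i"
  shows "H z < 1"
proof -
  obtain i where i: "i \<in> I" using index_nonempty by auto
  have "H z \<le> frechet (z i)" by (rule le_frechet[OF i])
  also have "\<dots> < 1" using assms[OF i] by (simp add: frechet_def)
  finally show ?thesis .
qed

text \<open>Right-continuity of \<open>H\<close>, phrased with the levels y_i + 1/(k+1) of
  \<open>random_variable_of_chain\<close>. Imposing all levels with k up to m keeps each constraint
  set finite and makes the events decrease; \<open>S\<close> is kept as an additional fixed
  constraint.\<close>

lemma prob_cyl_LIMSEQ:
  assumes S: "finite S" "fst ` S \<subseteq> I"
  shows "(\<lambda>m. prob (cyl ((\<lambda>(i, k). (i, y i + 1 / real (Suc k))) ` (I \<times> {..m}) \<union> S)))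
    \<longlonglongrightarrow> prob (cyl ((\<lambda>i. (i, y i)) ` I \<union> S))"
proof -
  let ?E = "\<lambda>m. cyl ((\<lambda>(i, k). (i, y i + 1 / real (Suc k))) ` (I \<times> {..m}) \<union> S)"
  have E_iff: "x \<in> ?E m \<longleftrightarrow> x \<in> cyl S \<and> (\<forall>i\<in>I. \<forall>k\<le>m. x i \<le> y i + 1 / real (Suc k))" for x m
    unfolding cyl_def ball_Un ball_simps by (simp del: of_nat_Suc) blast
  have "range ?E \<subseteq> events"
    using S finite_index by (intro image_subsetI cyl_sets sets_df_measure[OF df]) auto
  moreover have "decseq ?E"
  proof (rule decseq_SucI, rule subsetI)
    fix m x assume "x \<in> ?E (Suc m)"
    then show "x \<in> ?E m" unfolding E_iff by (meson le_SucI)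
  qed
  ultimately have "(\<lambda>m. prob (?E m)) \<longlonglongrightarrow> prob (\<Inter>m. ?E m)"
    by (rule finite_Lim_measure_decseq)
  also have "(\<Inter>m. ?E m) = cyl ((\<lambda>i. (i, y i)) ` I \<union> S)"
  proof -
    have le: "a \<le> b \<longleftrightarrow> (\<forall>k. a \<le> b + 1 / real (Suc k))" for a b :: real
    proof
      assume *: "\<forall>k. a \<le> b + 1 / real (Suc k)"
      have "(\<lambda>k. b + 1 / real (Suc k)) \<longlonglongrightarrow> b" by real_asymp
      then show "a \<le> b" by (rule LIMSEQ_le_const) (use * in blast)
    qed (simp add: add_increasing2)
    show ?thesis
    proof (rule set_eqI)
      fix x
      have "x \<in> (\<Inter>m. ?E m) \<longleftrightarrow> x \<in> cyl S \<and> (\<forall>i\<in>I. \<forall>k. x i \<le> y i + 1 / real (Suc k))"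
        unfolding INT_iff E_iff by blast
      also have "(\<forall>i\<in>I. \<forall>k. x i \<le> y i + 1 / real (Suc k)) \<longleftrightarrow> (\<forall>i\<in>I. x i \<le> y i)"
        by (intro ball_cong refl le[symmetric])
      also have "x \<in> cyl S \<and> (\<forall>i\<in>I. x i \<le> y i) \<longleftrightarrow> x \<in> cyl ((\<lambda>i. (i, y i)) ` I \<union> S)"
        by (auto simp: cyl_def ball_Un)
      finally show "x \<in> (\<Inter>m. ?E m) \<longleftrightarrow> x \<in> cyl ((\<lambda>i. (i, y i)) ` I \<union> S)" .
    qed
  qed
  finally show ?thesis .
qed

end

text \<open>Numerator and denominator both vanish like 1/n; after multiplication by n each term
  converges to a logarithm. The quotient is the probability of a cylinder under the law of H^{1/n}
  conditioned on leaving a box.\<close>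

lemma powr_difference_quotient_LIMSEQ:
  fixes a b e :: real
  assumes "0 < a" "0 < b" "0 < e" "e < 1"
  shows "(\<lambda>n. (a powr (1 / real (Suc n)) - b powr (1 / real (Suc n))) / (1 - e powr (1 / real (Suc n))))
    \<longlonglongrightarrow> (ln a - ln b) / - ln e"
proof -
  have 1: "(\<lambda>n. real (Suc n) * (1 - x powr (1 / real (Suc n)))) \<longlonglongrightarrow> - ln x" if "0 < x" for x
  proof -
    have "(\<lambda>n. real (Suc n) * (1 - exp (c / real (Suc n)))) \<longlonglongrightarrow> - c" for c
      by real_asymp
    from this[of "ln x"] show ?thesis using that by (simp add: powr_def)
  qed
  have "(\<lambda>n. (real (Suc n) * (1 - b powr (1 / real (Suc n))) - real (Suc n) * (1 - a powr (1 / real (Suc n))))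
      / (real (Suc n) * (1 - e powr (1 / real (Suc n))))) \<longlonglongrightarrow> (- ln b - - ln a) / - ln e"
    using assms by (intro tendsto_divide tendsto_diff 1) auto
  moreover have "(real (Suc n) * (1 - b powr (1 / real (Suc n))) - real (Suc n) * (1 - a powr (1 / real (Suc n))))
      / (real (Suc n) * (1 - e powr (1 / real (Suc n))))
    = (a powr (1 / real (Suc n)) - b powr (1 / real (Suc n))) / (1 - e powr (1 / real (Suc n)))" for n
    by (simp add: right_diff_distrib[symmetric] del: of_nat_Suc)
  ultimately show ?thesis by simp
qed

context max_id_frechet
begin

lemma prob_cyl_graph: "prob (cyl ((\<lambda>i. (i, y i)) ` I)) = H y"
  unfolding df_eq_measure[OF df, of y] by (simp add: cyl_def space_df_measure[OF df])

lemma prob_cyl_graph_Un: "prob (cyl ((\<lambda>i. (i, y i)) ` I \<union> (\<lambda>i. (i, c)) ` I)) = H (\<lambda>i. min (y i) c)"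
  unfolding df_eq_measure[OF df, of "\<lambda>i. min (y i) c"]
  by (rule arg_cong[where f=prob]) (auto simp: cyl_def space_df_measure[OF df] ball_Un)

text \<open>The measure obtained is an exponent measure restricted to the complement of the box
  [0,c]^I: its total mass is that of the complement, and a box [0,y] receives what lies in it
  outside [0,c]^I. It is finite, so it can be built as a multiple of a probability measure.\<close>

lemma exponent_shell_exists:
  assumes c: "0 < c"
  shows "\<exists>\<nu> :: (nat \<Rightarrow> ereal) measure. sets \<nu> = sets (PiM I (\<lambda>_. borel)) \<and>
    emeasure \<nu> (space \<nu>) = ennreal (- ln (H (\<lambda>_. c))) \<and>
    (AE x in \<nu>. \<forall>i\<in>I. 0 \<le> x i) \<and>
    (\<forall>y. (\<forall>i\<in>I. 0 < y i) \<longrightarrow> emeasure \<nu> {x\<in>space \<nu>. \<forall>i\<in>I. x i \<le> ereal (y i)}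
        = ennreal (ln (H y) - ln (H (\<lambda>i. min (y i) c))))"
proof -
  define C where "C = (\<lambda>i. (i, c)) ` I"
  have C: "finite C" "fst ` C \<subseteq> I" "C \<subseteq> I \<times> {0<..}" using c finite_index by (auto simp: C_def)
  have HC: "prob (cyl C) = H (\<lambda>_. c)" unfolding C_def by (rule prob_cyl_graph)
  have HC01: "0 < H (\<lambda>_. c)" "H (\<lambda>_. c) < 1" using pos less_1 c by auto
  \<comment> \<open>The limiting conditional probability of \<open>cyl S\<close>. Adding
    \<open>C\<close> to the constraints cuts out the part inside the box, and the denominator is the
    mass of its complement.\<close>
  define p where "p S = (ln (prob (cyl S)) - ln (prob (cyl (S \<union> C)))) / - ln (H (\<lambda>_. c))" for S
  define M where "M n = df_measure I (\<lambda>x. H x powr (1 / real (Suc n)))" for n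
  define D where "D = space (PiM I (\<lambda>_. borel :: real measure)) - cyl C"
  \<comment> \<open>The law of H^{1/(n+1)} conditioned on leaving the box; the shift avoids the
    exponent 1/0.\<close>
  define R where "R n = uniform_measure (M n) D" for n
  let ?J = "I \<times> {0::real<..}"
  have M: "prob_space (M n)" "sets (M n) = sets (PiM I (\<lambda>_. borel))" "space (M n) = space (PiM I (\<lambda>_. borel))" for n
    using is_dfD(1-3)[OF df_powr[of "1 / real (Suc n)"]] by (auto simp: M_def)
  have Mcyl: "measure (M n) (cyl S) = prob (cyl S) powr (1 / real (Suc n))" if "finite S" "S \<subseteq> ?J" for n S
    unfolding M_def by (rule measure_cyl_powr) (use that in auto)
  have cylM: "cyl S \<in> sets (M n)" if "finite S" "S \<subseteq> ?J" for n S
    by (rule cyl_sets[OF that(1) _ M(2)]) (use that(2) in auto)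
  have DM: "D \<in> sets (M n)" for n
    unfolding D_def using cylM[OF C(1,3)] M(3) by (metis sets.compl_sets)
  have Ddiff: "measure (M n) (cyl S \<inter> D) = prob (cyl S) powr (1 / real (Suc n)) - prob (cyl (S \<union> C)) powr (1 / real (Suc n))"
    if S: "finite S" "S \<subseteq> ?J" for n S
  proof -
    interpret Mn: prob_space "M n" by (rule M)
    have "cyl S \<inter> D = cyl S - cyl (S \<union> C)" "cyl (S \<union> C) \<subseteq> cyl S"
      unfolding D_def cyl_def by auto
    then show ?thesis
      using Mn.finite_measure_Diff[of "cyl S" "cyl (S \<union> C)"] cylM[of S n] cylM[of "S \<union> C" n] S C(1,3) Mcyl[of S n] Mcyl[of "S \<union> C" n]
      by simp
  qed
  \<comment> \<open>The empty constraint set is the whole space, so the mass of \<open>D\<close> is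
    the special case of \<open>Ddiff\<close> without constraints.\<close>
  have cylD: "cyl {} \<inter> D = D" unfolding D_def cyl_def by auto
  have D_meas: "measure (M n) D = 1 - H (\<lambda>_. c) powr (1 / real (Suc n))" for n
    using Ddiff[of "{}" n] Mcyl[of "{}" n] HC prob_space.prob_space[OF M(1), of n] prob_space
    unfolding cylD by (simp add: cyl_def M(3)[of n, symmetric] space_df_measure[OF df, symmetric])
  have "measure (M n) D > 0" for n
    unfolding D_meas using HC01 powr_less_mono2[of "1 / real (Suc n)" "H (\<lambda>_. c)" 1] by simp
  then have D0: "emeasure (M n) D \<noteq> 0" "emeasure (M n) D \<noteq> \<infinity>" for n
  proof -
    interpret Mn: prob_space "M n" by (rule M)
    show "emeasure (M n) D \<noteq> 0" "emeasure (M n) D \<noteq> \<infinity>"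
      using \<open>measure (M n) D > 0\<close> by (auto simp: Mn.emeasure_eq_measure)
  qed
  have "prob_space (R n)" for n
    unfolding R_def using D0 by (rule prob_space_uniform_measure)
  moreover have "cyl {j} \<in> sets (R n)" if "j \<in> ?J" for n j
    unfolding R_def using cylM[of "{j}" n] that by simp
  moreover have "(\<lambda>n. measure (R n) {x\<in>space (R n). \<forall>j\<in>S. x \<in> cyl {j}}) \<longlonglongrightarrow> p S"
    if S: "finite S" "S \<subseteq> ?J" for S
  proof -
    have "{x\<in>space (R n). \<forall>j\<in>S. x \<in> cyl {j}} = cyl S" for n
      by (auto simp: R_def M(3) cyl_def)
    moreover have "measure (R n) (cyl S) = (prob (cyl S) powr (1 / real (Suc n)) - prob (cyl (S \<union> C)) powr (1 / real (Suc n)))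
        / (1 - H (\<lambda>_. c) powr (1 / real (Suc n)))" for n
      unfolding R_def using measure_uniform_measure[OF D0 cylM[OF S], of n] Ddiff[OF S, of n]
      by (simp add: Int_commute D_meas)
    moreover have "0 < prob (cyl S)" "0 < prob (cyl (S \<union> C))"
      using S C by (auto intro!: prob_cyl_pos)
    ultimately show ?thesis
      unfolding p_def
      using powr_difference_quotient_LIMSEQ[of "prob (cyl S)" "prob (cyl (S \<union> C))" "H (\<lambda>_. c)"] HC01
      by (simp del: of_nat_Suc)
  qed
  ultimately have "\<exists>(L :: (nat \<times> real \<Rightarrow> real) measure) B. prob_space L \<and> (\<forall>j\<in>?J. B j \<in> sets L) \<and>
      (\<forall>S. finite S \<longrightarrow> S \<subseteq> ?J \<longrightarrow> measure L {x\<in>space L. \<forall>j\<in>S. x \<in> B j} = p S)"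
    by (rule limit_events_exist)
  then obtain L :: "(nat \<times> real \<Rightarrow> real) measure" and B where
    LB0: "prob_space L \<and> (\<forall>j\<in>?J. B j \<in> sets L) \<and>
      (\<forall>S. finite S \<longrightarrow> S \<subseteq> ?J \<longrightarrow> measure L {x\<in>space L. \<forall>j\<in>S. x \<in> B j} = p S)"
    by (elim exE)
  have L: "prob_space L" and B: "\<And>j. j \<in> ?J \<Longrightarrow> B j \<in> sets L"
    and LB: "\<And>S. \<lbrakk>finite S; S \<subseteq> ?J\<rbrakk> \<Longrightarrow> measure L {\<omega>\<in>space L. \<forall>j\<in>S. \<omega> \<in> B j} = p S"
    using conjunct1[OF LB0] conjunct1[OF conjunct2[OF LB0]] conjunct2[OF conjunct2[OF LB0]] by auto
  interpret L: prob_space L by (rule L)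
  \<comment> \<open>The events \<open>B\<close> are abstract, so inclusion can only be read off from
    measures: a redundant larger level leaves the cylinder, hence \<open>p\<close>,
    unchanged.\<close>
  have mono: "AE \<omega> in L. \<omega> \<in> B (i, q) \<longrightarrow> \<omega> \<in> B (i, q')" if i: "i \<in> I" and q: "0 < q" "q \<le> q'" for i q q'
  proof -
    have "cyl {(i, q), (i, q')} = cyl {(i, q)}" "cyl ({(i, q), (i, q')} \<union> C) = cyl ({(i, q)} \<union> C)"
      using q by (auto simp: cyl_def)
    then have "p {(i, q), (i, q')} = p {(i, q)}" unfolding p_def by simp
    moreover have J: "(i, q) \<in> ?J" "(i, q') \<in> ?J" using i q by auto
    moreover have "{\<omega>\<in>space L. \<forall>j\<in>{(i, q), (i, q')}. \<omega> \<in> B j} = B (i, q) \<inter> B (i, q')"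
      "{\<omega>\<in>space L. \<forall>j\<in>{(i, q)}. \<omega> \<in> B j} = B (i, q)"
      using sets.sets_into_space[OF B[OF J(1)]] by auto
    ultimately have "measure L (B (i, q) \<inter> B (i, q')) = measure L (B (i, q))"
      using LB[of "{(i, q), (i, q')}"] LB[of "{(i, q)}"] by simp
    then have "measure L (B (i, q) - B (i, q')) = 0"
      using L.finite_measure_Diff'[OF B[OF J(1)] B[OF J(2)]] by simp
    then show ?thesis
      using B[OF J(1)] B[OF J(2)]
      by (intro AE_I[where N="B (i, q) - B (i, q')"]) (auto simp: L.emeasure_eq_measure)
  qed
  have "\<exists>X. X \<in> borel_measurable L \<and> (\<forall>\<omega>. 0 \<le> X \<omega>) \<and>
      (\<forall>y>0. AE \<omega> in L. X \<omega> \<le> ereal y \<longleftrightarrow> (\<forall>k::nat. \<omega> \<in> B (i, y + 1 / real (Suc k))))" if i: "i \<in> I" for i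
  proof -
    have "B (i, q) \<in> sets L" if "0 < q" for q using B i that by auto
    then show ?thesis by (rule random_variable_of_chain[OF _ mono[OF i]])
  qed
  then have "\<exists>X. \<forall>i\<in>I. X i \<in> borel_measurable L \<and> (\<forall>\<omega>. 0 \<le> X i \<omega>) \<and>
      (\<forall>y>0. AE \<omega> in L. X i \<omega> \<le> ereal y \<longleftrightarrow> (\<forall>k::nat. \<omega> \<in> B (i, y + 1 / real (Suc k))))"
    by (intro bchoice ballI)
  then obtain X where XX: "\<forall>i\<in>I. X i \<in> borel_measurable L \<and> (\<forall>\<omega>. 0 \<le> X i \<omega>) \<and>
      (\<forall>y>0. AE \<omega> in L. X i \<omega> \<le> ereal y \<longleftrightarrow> (\<forall>k::nat. \<omega> \<in> B (i, y + 1 / real (Suc k))))"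
    by (elim exE)
  have X[measurable]: "X i \<in> borel_measurable L" and X0: "0 \<le> X i \<omega>"
    and XB: "0 < y \<Longrightarrow> AE \<omega> in L. X i \<omega> \<le> ereal y \<longleftrightarrow> (\<forall>k::nat. \<omega> \<in> B (i, y + 1 / real (Suc k)))"
    if "i \<in> I" for i y \<omega>
    using bspec[OF XX that] by blast+
  have law: "measure L {\<omega>\<in>space L. \<forall>i\<in>I. X i \<omega> \<le> ereal (y i)} = (ln (H y) - ln (H (\<lambda>i. min (y i) c))) / - ln (H (\<lambda>_. c))"
    if y: "\<And>i. i \<in> I \<Longrightarrow> 0 < y i" for y
  proof -
    \<comment> \<open>By \<open>XB\<close> the event X \<le> y is, up to null sets, the occurrence
      of \<open>B\<close> at all these levels as m grows; \<open>prob_cyl_LIMSEQ\<close> evaluates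
      the limit.\<close>
    let ?S = "\<lambda>m. (\<lambda>(i, k). (i, y i + 1 / real (Suc k))) ` (I \<times> {..m})"
    have S: "finite (?S m)" "?S m \<subseteq> ?J" for m using finite_index y by (auto intro: add_pos_pos)
    define E where "E m = {\<omega>\<in>space L. \<forall>j\<in>?S m. \<omega> \<in> B j}" for m
    have E_iff: "\<omega> \<in> E m \<longleftrightarrow> \<omega> \<in> space L \<and> (\<forall>i\<in>I. \<forall>k\<le>m. \<omega> \<in> B (i, y i + 1 / real (Suc k)))" for \<omega> m
      unfolding E_def by (simp del: of_nat_Suc) blast
    have EM: "E m \<in> sets L" for m
      unfolding E_def using S[of m] B by (intro sets.sets_Collect_finite_All) auto
    have "decseq E"
    proof (rule decseq_SucI, rule subsetI)
      fix m \<omega> assume "\<omega> \<in> E (Suc m)"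
      then show "\<omega> \<in> E m" unfolding E_iff by (meson le_SucI)
    qed
    then have 1: "(\<lambda>m. measure L (E m)) \<longlonglongrightarrow> measure L (\<Inter>m. E m)"
      using EM by (intro L.finite_Lim_measure_decseq) auto
    have "(\<lambda>m. p (?S m)) \<longlonglongrightarrow> (ln (H y) - ln (H (\<lambda>i. min (y i) c))) / - ln (H (\<lambda>_. c))"
    proof -
      have "H y \<noteq> 0" "H (\<lambda>i. min (y i) c) \<noteq> 0" "ln (H (\<lambda>_. c)) \<noteq> 0"
        using pos[of y] pos[of "\<lambda>i. min (y i) c"] y c HC01 by auto
      then show ?thesis
        unfolding p_def
        using prob_cyl_LIMSEQ[of "{}" y] prob_cyl_LIMSEQ[OF C(1,2), of y]
        by (intro tendsto_divide tendsto_diff tendsto_ln tendsto_const)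
          (simp_all add: prob_cyl_graph prob_cyl_graph_Un C_def del: of_nat_Suc)
    qed
    moreover have "p (?S m) = measure L (E m)" for m
      unfolding E_def using LB[OF S] by simp
    ultimately have "measure L (\<Inter>m. E m) = (ln (H y) - ln (H (\<lambda>i. min (y i) c))) / - ln (H (\<lambda>_. c))"
      using LIMSEQ_unique[OF 1] by simp
    moreover have "measure L {\<omega>\<in>space L. \<forall>i\<in>I. X i \<omega> \<le> ereal (y i)} = measure L (\<Inter>m. E m)"
    proof (rule measure_eq_AE)
      have "AE \<omega> in L. \<forall>i\<in>I. X i \<omega> \<le> ereal (y i) \<longleftrightarrow> (\<forall>k::nat. \<omega> \<in> B (i, y i + 1 / real (Suc k)))"
        by (rule AE_finite_allI[OF finite_index]) (rule XB, use y in auto)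
      then show "AE \<omega> in L. \<omega> \<in> {\<omega>\<in>space L. \<forall>i\<in>I. X i \<omega> \<le> ereal (y i)} \<longleftrightarrow> \<omega> \<in> (\<Inter>m. E m)"
        using AE_space
      proof eventually_elim
        fix \<omega> assume *: "\<forall>i\<in>I. X i \<omega> \<le> ereal (y i) \<longleftrightarrow> (\<forall>k::nat. \<omega> \<in> B (i, y i + 1 / real (Suc k)))"
          and \<omega>: "\<omega> \<in> space L"
        have "\<omega> \<in> (\<Inter>m. E m) \<longleftrightarrow> (\<forall>i\<in>I. \<forall>k. \<omega> \<in> B (i, y i + 1 / real (Suc k)))"
          unfolding INT_iff E_iff using \<omega> by blast
        also have "\<dots> \<longleftrightarrow> (\<forall>i\<in>I. X i \<omega> \<le> ereal (y i))" using * by blast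
        finally show "\<omega> \<in> {\<omega>\<in>space L. \<forall>i\<in>I. X i \<omega> \<le> ereal (y i)} \<longleftrightarrow> \<omega> \<in> (\<Inter>m. E m)"
          using \<omega> by simp
      qed
      show "{\<omega>\<in>space L. \<forall>i\<in>I. X i \<omega> \<le> ereal (y i)} \<in> sets L"
        using finite_index by measurable
      show "(\<Inter>m. E m) \<in> sets L" using EM by auto
    qed
    ultimately show ?thesis by simp
  qed
  let ?N = "distr L (PiM I (\<lambda>_. borel)) (\<lambda>\<omega>. \<lambda>i\<in>I. X i \<omega>)"
  have V: "(\<lambda>\<omega>. \<lambda>i\<in>I. X i \<omega>) \<in> measurable L (PiM I (\<lambda>_. borel))" by measurable
  \<comment> \<open>Scaling undoes the normalisation by the mass outside the box.\<close>
  define \<nu> where "\<nu> = scale_measure (ennreal (- ln (H (\<lambda>_. c)))) ?N"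
  have sp: "space \<nu> = space (PiM I (\<lambda>_. borel))" by (simp add: \<nu>_def space_scale_measure)
  show ?thesis
  proof (intro exI[of _ \<nu>] conjI allI impI)
    show sets: "sets \<nu> = sets (PiM I (\<lambda>_. borel))" by (simp add: \<nu>_def)
    interpret N: prob_space ?N by (rule L.prob_space_distr[OF V])
    show "emeasure \<nu> (space \<nu>) = ennreal (- ln (H (\<lambda>_. c)))"
      using N.emeasure_space_1 unfolding \<nu>_def by (simp add: space_scale_measure)
    show "AE x in \<nu>. \<forall>i\<in>I. 0 \<le> x i"
    proof (rule AE_finite_allI[OF finite_index])
      fix i assume i: "i \<in> I"
      have Z: "{x\<in>space \<nu>. \<not> 0 \<le> x i} \<in> sets (PiM I (\<lambda>_. borel))"
        using i unfolding sp by measurable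
      have "emeasure \<nu> {x\<in>space \<nu>. \<not> 0 \<le> x i} = 0"
        using i X0[OF i] Z
        by (simp add: emeasure_distr[OF V] space_scale_measure \<nu>_def)
      then show "AE x in \<nu>. 0 \<le> x i"
        using Z sets by (intro AE_I[where N="{x\<in>space \<nu>. \<not> 0 \<le> x i}"]) auto
    qed
    fix y :: "nat \<Rightarrow> real" assume y: "\<forall>i\<in>I. 0 < y i"
    let ?A = "{x\<in>space \<nu>. \<forall>i\<in>I. x i \<le> ereal (y i)}"
    have A: "?A \<in> sets (PiM I (\<lambda>_. borel))"
      using finite_index unfolding sp by measurable
    have "emeasure \<nu> ?A = ennreal (- ln (H (\<lambda>_. c))) * emeasure ?N ?A" by (simp add: \<nu>_def)
    also have "emeasure ?N ?A = emeasure L {\<omega>\<in>space L. \<forall>i\<in>I. X i \<omega> \<le> ereal (y i)}"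
      by (subst emeasure_distr[OF V A]) (auto simp: sp space_PiM intro!: arg_cong[where f="emeasure L"])
    also have "\<dots> = ennreal ((ln (H y) - ln (H (\<lambda>i. min (y i) c))) / - ln (H (\<lambda>_. c)))"
      using law[of y] y by (simp add: L.emeasure_eq_measure)
    also have "ennreal (- ln (H (\<lambda>_. c))) * \<dots> = ennreal (ln (H y) - ln (H (\<lambda>i. min (y i) c)))"
      using HC01 by (subst ennreal_mult'[symmetric]) auto
    finally show "emeasure \<nu> ?A = ennreal (ln (H y) - ln (H (\<lambda>i. min (y i) c)))" .
  qed
qed

end

section \<open>Gluing the shells into one measure\<close>

lemma suminf_measure_exists:
  fixes N :: "nat \<Rightarrow> 'a measure"
  assumes N: "\<And>k. sets (N k) = sets M"
  shows "\<exists>\<nu>. sets \<nu> = sets M \<and> (\<forall>A\<in>sets M. emeasure \<nu> A = (\<Sum>k. emeasure (N k) A))"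
proof -
  define \<nu> where "\<nu> = measure_of (space M) (sets M) (\<lambda>A. \<Sum>k. emeasure (N k) A)"
  have s: "sets \<nu> = sets M" unfolding \<nu>_def by simp
  moreover have "emeasure \<nu> A = (\<Sum>k. emeasure (N k) A)" if A: "A \<in> sets M" for A
  proof (rule emeasure_measure_of[OF \<nu>_def])
    show "countably_additive (sets \<nu>) (\<lambda>A. \<Sum>k. emeasure (N k) A)"
    proof (rule countably_additiveI)
      fix A :: "nat \<Rightarrow> 'a set" assume A: "range A \<subseteq> sets \<nu>" "disjoint_family A"
      \<comment> \<open>The sum over k is read as an integral for counting measure, which allows the
        two nonnegative series to be exchanged.\<close>
      have "(\<Sum>i. \<Sum>k. emeasure (N k) (A i)) = (\<Sum>i. \<integral>\<^sup>+k. emeasure (N k) (A i) \<partial>count_space UNIV)"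
        by (simp add: nn_integral_count_space_nat)
      also have "\<dots> = (\<integral>\<^sup>+k. (\<Sum>i. emeasure (N k) (A i)) \<partial>count_space UNIV)"
        by (rule nn_integral_suminf[symmetric]) simp
      also have "\<dots> = (\<Sum>k. emeasure (N k) (\<Union>i. A i))"
        using A by (simp add: nn_integral_count_space_nat suminf_emeasure N s)
      finally show "(\<Sum>i. \<Sum>k. emeasure (N k) (A i)) = (\<Sum>k. emeasure (N k) (\<Union>i. A i))" .
    qed
  qed (use A s sets.space_closed in \<open>auto simp: positive_def\<close>)
  ultimately show ?thesis by blast
qed

context max_id_frechet
begin

lemma mono: "(\<And>i. i \<in> I \<Longrightarrow> x i \<le> y i) \<Longrightarrow> H x \<le> H y"
  unfolding df_eq_measure[OF df, of x] df_eq_measure[OF df, of y]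
  by (rule finite_measure_mono)
    (use sets_orthant[OF finite_index order_refl sets_df_measure[OF df]] in \<open>auto intro: order_trans\<close>)

lemma ln_mono: "(\<And>i. i \<in> I \<Longrightarrow> 0 < x i) \<Longrightarrow> (\<And>i. i \<in> I \<Longrightarrow> x i \<le> y i) \<Longrightarrow> ln (H x) \<le> ln (H y)"
  using mono[of x y] pos[of x] by simp

text \<open>The exponent measure is the sum over k of the shell measures for c = 1/(k+1), each restricted
  to the box where all coordinates are at most 1/k; their values telescope.\<close>
lemma exponent_measure_exists: "\<exists>\<upsilon>. is_exponent_measure I H \<upsilon>"
proof -
  define c where "c k = 1 / real (Suc k)" for k
  have c: "0 < c k" "c (Suc k) \<le> c k" for k by (auto simp: c_def field_simps)
  let ?P = "PiM I (\<lambda>_. borel :: ereal measure)"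
  define box where "box y = {x\<in>space ?P. \<forall>i\<in>I. x i \<le> ereal (y i)}" for y :: "nat \<Rightarrow> real"
  have box: "box y \<in> sets ?P" for y
    unfolding box_def using finite_index by measurable
  have "\<exists>\<nu>. sets \<nu> = sets ?P \<and> emeasure \<nu> (space \<nu>) = ennreal (- ln (H (\<lambda>_. c k))) \<and>
      (AE x in \<nu>. \<forall>i\<in>I. 0 \<le> x i) \<and>
      (\<forall>y. (\<forall>i\<in>I. 0 < y i) \<longrightarrow> emeasure \<nu> {x\<in>space \<nu>. \<forall>i\<in>I. x i \<le> ereal (y i)}
        = ennreal (ln (H y) - ln (H (\<lambda>i. min (y i) (c k)))))" for k
    by (rule exponent_shell_exists[OF c(1)])
  then have "\<exists>\<nu>. \<forall>k. sets (\<nu> k) = sets ?P \<and> emeasure (\<nu> k) (space (\<nu> k)) = ennreal (- ln (H (\<lambda>_. c k))) \<and>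
      (AE x in \<nu> k. \<forall>i\<in>I. 0 \<le> x i) \<and>
      (\<forall>y. (\<forall>i\<in>I. 0 < y i) \<longrightarrow> emeasure (\<nu> k) {x\<in>space (\<nu> k). \<forall>i\<in>I. x i \<le> ereal (y i)}
        = ennreal (ln (H y) - ln (H (\<lambda>i. min (y i) (c k)))))"
    by (intro choice allI)
  then obtain \<nu> where nu: "\<forall>k. sets (\<nu> k) = sets ?P \<and> emeasure (\<nu> k) (space (\<nu> k)) = ennreal (- ln (H (\<lambda>_. c k))) \<and>
      (AE x in \<nu> k. \<forall>i\<in>I. 0 \<le> x i) \<and>
      (\<forall>y. (\<forall>i\<in>I. 0 < y i) \<longrightarrow> emeasure (\<nu> k) {x\<in>space (\<nu> k). \<forall>i\<in>I. x i \<le> ereal (y i)}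
        = ennreal (ln (H y) - ln (H (\<lambda>i. min (y i) (c k)))))"
    by (elim exE)
  have sets: "sets (\<nu> k) = sets ?P" for k using nu by blast
  have sp: "space (\<nu> k) = space ?P" for k using sets by (rule sets_eq_imp_space_eq)
  have total: "emeasure (\<nu> k) (space ?P) = ennreal (- ln (H (\<lambda>_. c k)))" for k using nu sp by metis
  have nonneg: "AE x in \<nu> k. \<forall>i\<in>I. 0 \<le> x i" for k using nu by blast
  have nu_box: "emeasure (\<nu> k) (box y) = ennreal (ln (H y) - ln (H (\<lambda>i. min (y i) (c k))))"
    if "\<And>i. i \<in> I \<Longrightarrow> 0 < y i" for y k
    using nu that unfolding box_def sp by blast
  have not_box: "AE x in \<nu> k. x \<notin> box (\<lambda>_. c k)" for k
    by (rule AE_I[where N="box (\<lambda>_. c k)"]) (use nu_box[of "\<lambda>_. c k" k] c box sets in auto)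
  \<comment> \<open>Since \<open>\<nu> k\<close> gives no mass to the box of side c_k, restricting
    it to the box of side c_{k-1} leaves exactly one shell; k = 0 takes everything outside the first
    box.\<close>
  define U where "U k = (if k = 0 then space ?P else box (\<lambda>_. c (k - 1)))" for k
  have U: "U k \<in> sets ?P" for k using box by (simp add: U_def)
  define N where "N k = density (\<nu> k) (indicator (U k))" for k
  have N: "emeasure (N k) A = emeasure (\<nu> k) (A \<inter> U k)" if "A \<in> sets ?P" for k A
    using that U[of k] sets[of k] unfolding N_def
    by (simp add: emeasure_density Int_commute flip: indicator_inter_arith)
  have "sets (N k) = sets ?P" for k by (simp add: N_def sets)
  then obtain \<upsilon> where su: "sets \<upsilon> = sets ?P" and eu: "\<And>A. A \<in> sets ?P \<Longrightarrow> emeasure \<upsilon> A = (\<Sum>k. emeasure (N k) A)"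
    using suminf_measure_exists[of N ?P] by blast
  have spu: "space \<upsilon> = space ?P" using su by (rule sets_eq_imp_space_eq)
  have E: "E_set I \<in> sets ?P"
  proof -
    have "E_set I = {x\<in>space ?P. (\<forall>i\<in>I. 0 \<le> x i) \<and> \<not> (\<forall>i\<in>I. x i = 0)}"
      by (auto simp: E_set_def space_PiM PiE_iff extensional_def fun_eq_iff)
    also have "\<dots> \<in> sets ?P" using finite_index by measurable
    finally show ?thesis .
  qed
  have AE_E: "AE x in \<nu> k. x \<in> E_set I" for k
    using nonneg not_box[of k] AE_space
  proof eventually_elim
    fix x assume x: "\<forall>i\<in>I. 0 \<le> x i" "x \<notin> box (\<lambda>_. c k)" "x \<in> space (\<nu> k)"
    then show "x \<in> E_set I"
      using c(1)[of k] by (auto simp: E_set_def box_def sp space_PiM PiE_iff less_imp_le)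
  qed
  have "is_exponent_measure I H \<upsilon>"
    unfolding is_exponent_measure_def
  proof (intro conjI ballI)
    show "emeasure \<upsilon> (space \<upsilon> - E_set I) = 0"
    proof -
      have "emeasure (N k) (space \<upsilon> - E_set I) = 0" for k
      proof -
        have "emeasure (\<nu> k) ((space ?P - E_set I) \<inter> U k) = emeasure (\<nu> k) {}"
          by (rule emeasure_eq_AE) (use AE_E[of k] E U sets in \<open>auto elim!: eventually_mono\<close>)
        then show ?thesis using N[of "space ?P - E_set I" k] E by (simp add: spu sets.compl_sets)
      qed
      then show ?thesis using eu[of "space ?P - E_set I"] E by (simp add: spu sets.compl_sets)
    qed
    fix x assume "x \<in> PiE I (\<lambda>_. {0::real<..})"
    then have x: "\<And>i. i \<in> I \<Longrightarrow> 0 < x i" by auto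
    define A where "A = E_set I - PiE I (\<lambda>i. {0..ereal (x i)})"
    have A_eq: "A = E_set I - box x"
      by (auto simp: A_def E_set_def box_def space_PiM PiE_iff)
    then have A: "A \<in> sets ?P" using E box by auto
    \<comment> \<open>For positive k this is the mass of \<open>A\<close> still to be collected
      inside the box of side c_{k-1}, so shell k contributes a k - a (Suc k). It is 0 once that box
      lies inside [0,x], and a 0 is the desired total.\<close>
    define a where "a k = (if k = 0 then - ln (H x) else ln (H (\<lambda>_. c (k - 1))) - ln (H (\<lambda>i. min (x i) (c (k - 1)))))" for k
    have NA: "emeasure (N k) A = ennreal (a k - a (Suc k)) \<and> 0 \<le> a k - a (Suc k)" for k
    proof -
      have fin: "emeasure (\<nu> k) B \<noteq> \<infinity>" if "B \<in> sets ?P" for B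
        using emeasure_mono[OF sets.sets_into_space[OF that], of "\<nu> k"] total[of k] sets[of k]
        by (auto simp: top_unique)
      have "emeasure (N k) A = emeasure (\<nu> k) (U k - (U k \<inter> box x))"
        unfolding N[OF A]
        by (rule emeasure_eq_AE) (use AE_E[of k] A U box sets in \<open>auto elim!: eventually_mono simp: A_eq\<close>)
      also have "\<dots> = emeasure (\<nu> k) (U k) - emeasure (\<nu> k) (U k \<inter> box x)"
        using U box fin[of "U k \<inter> box x"] by (intro emeasure_Diff) (auto simp: sets)
      finally have eq: "emeasure (N k) A = emeasure (\<nu> k) (U k) - emeasure (\<nu> k) (U k \<inter> box x)" .
      have le: "emeasure (\<nu> k) (U k \<inter> box x) \<le> emeasure (\<nu> k) (U k)"
        using U by (intro emeasure_mono) (auto simp: sets)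
      have combine: "emeasure (N k) A = ennreal (a k - a (Suc k)) \<and> 0 \<le> a k - a (Suc k)"
        if "emeasure (\<nu> k) (U k) = ennreal \<alpha>" "emeasure (\<nu> k) (U k \<inter> box x) = ennreal \<beta>"
          "0 \<le> \<alpha>" "0 \<le> \<beta>" "\<alpha> - \<beta> = a k - a (Suc k)" for \<alpha> \<beta>
        using that le eq by (simp add: ennreal_minus)
      show ?thesis
      proof (cases k)
        case 0
        show ?thesis
        proof (rule combine)
          show "emeasure (\<nu> k) (U k) = ennreal (- ln (H (\<lambda>_. c k)))" using total 0 by (simp add: U_def)
          have "U k \<inter> box x = box x" using 0 by (auto simp: U_def box_def)
          then show "emeasure (\<nu> k) (U k \<inter> box x) = ennreal (ln (H x) - ln (H (\<lambda>i. min (x i) (c k))))"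
            using nu_box[OF x] by simp
          show "0 \<le> - ln (H (\<lambda>_. c k))" by (rule minus_ln_bounds) (rule c)
          show "0 \<le> ln (H x) - ln (H (\<lambda>i. min (x i) (c k)))"
            using ln_mono[of "\<lambda>i. min (x i) (c k)" x] x c by auto
        qed (use 0 in \<open>simp add: a_def\<close>)
      next
        case (Suc l)
        have mm: "min (c l) (c k) = c k" "min (min r (c l)) (c k) = min r (c k)" for r
          using c(2)[of l] Suc by (auto simp: min_def)
        show ?thesis
        proof (rule combine)
          show "emeasure (\<nu> k) (U k) = ennreal (ln (H (\<lambda>_. c l)) - ln (H (\<lambda>_. c k)))"
            using nu_box[of "\<lambda>_. c l" k] Suc c mm by (simp add: U_def)
          have "U k \<inter> box x = box (\<lambda>i. min (x i) (c l))" using Suc by (auto simp: U_def box_def)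
          then show "emeasure (\<nu> k) (U k \<inter> box x)
              = ennreal (ln (H (\<lambda>i. min (x i) (c l))) - ln (H (\<lambda>i. min (x i) (c k))))"
            using nu_box[of "\<lambda>i. min (x i) (c l)" k] x c mm by simp
          show "0 \<le> ln (H (\<lambda>_. c l)) - ln (H (\<lambda>_. c k))"
            using ln_mono[of "\<lambda>_. c k" "\<lambda>_. c l"] c Suc by auto
          show "0 \<le> ln (H (\<lambda>i. min (x i) (c l))) - ln (H (\<lambda>i. min (x i) (c k)))"
            using ln_mono[of "\<lambda>i. min (x i) (c k)" "\<lambda>i. min (x i) (c l)"] x c Suc
            by (auto intro: min.coboundedI2)
        qed (use Suc in \<open>simp add: a_def\<close>)
      qed
    qed
    have "a \<longlonglongrightarrow> 0"
    proof (rule tendsto_eventually)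
      have "c \<longlonglongrightarrow> 0" unfolding c_def by real_asymp
      then have "eventually (\<lambda>k. \<forall>i\<in>I. c k < x i) sequentially"
        using x finite_index by (subst eventually_ball_finite_distrib) (auto intro: order_tendstoD)
      then have "eventually (\<lambda>k. a (Suc k) = 0) sequentially"
      proof eventually_elim
        fix k assume "\<forall>i\<in>I. c k < x i"
        then have "H (\<lambda>i. min (x i) (c k)) = H (\<lambda>_. c k)"
          by (intro df_cong[OF df]) (auto simp: min_def)
        then show "a (Suc k) = 0" by (simp add: a_def)
      qed
      then show "eventually (\<lambda>k. a k = 0) sequentially"
        using eventually_sequentially_Suc[of "\<lambda>k. a k = 0"] by simp
    qed
    from telescope_sums'[OF this] have "(\<lambda>k. a k - a (Suc k)) sums (- ln (H x))" by (simp add: a_def)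
    then have "(\<lambda>k. ennreal (a k - a (Suc k))) sums ennreal (- ln (H x))"
      using NA minus_ln_bounds(1)[OF x] by (subst sums_ennreal) auto
    then have "emeasure \<upsilon> A = ennreal (- ln (H x))"
      unfolding eu[OF A] using NA by (simp add: sums_iff)
    then show "let A = E_set I - PiE I (\<lambda>i. {0..ereal (x i)}) in
        (emeasure \<upsilon> A < \<infinity> \<and> H x = exp (- enn2real (emeasure \<upsilon> A))) \<or> (emeasure \<upsilon> A = \<infinity> \<and> H x = 0)"
      unfolding Let_def A_def[symmetric] using minus_ln_bounds(1)[OF x] pos[OF x] by simp
  qed (rule su)
  then show ?thesis by blast
qed

end

section \<open>Marginals of the exponent measure\<close>

context max_id_frechet
begin

lemma marg_df_empty: "marg_df I H {} z = 1"
  using prob_space by (simp add: marg_df_eq[OF df])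

lemma marg_df_pos:
  assumes "T \<subseteq> I" "\<And>i. i \<in> T \<Longrightarrow> 0 < z i"
  shows "0 < marg_df I H T z"
proof (cases "T = {}")
  case False
  interpret T: max_id_frechet T "marg_df I H T" by (rule max_id_frechet_marg_df[OF assms(1) False])
  show ?thesis by (rule T.pos[OF assms(2)])
qed (simp add: marg_df_empty)

lemma exponent_measure: "is_exponent_measure I H (exponent_measure I H)"
  unfolding exponent_measure_def by (rule someI_ex[OF exponent_measure_exists])

lemma sets_exponent_measure: "sets (exponent_measure I H) = sets (PiM I (\<lambda>_. borel))"
  using exponent_measure by (simp add: is_exponent_measure_def)

lemma space_exponent_measure: "space (exponent_measure I H) = space (PiM I (\<lambda>_. borel))"
  using sets_exponent_measure by (rule sets_eq_imp_space_eq)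

lemma exponent_measurable[measurable]: "i \<in> I \<Longrightarrow> (\<lambda>w. w i) \<in> borel_measurable (exponent_measure I H)"
  using sets_exponent_measure by (simp cong: measurable_cong_sets)

text \<open>On \<open>E_set I\<close> leaving [0,x] means exceeding some x_i, and outside
  \<open>E_set I\<close> there is no mass. Positivity of \<open>H\<close> excludes the infinite
  alternative of the definition.\<close>

lemma emeasure_exponent_measure_exceed:
  assumes x: "\<And>i. i \<in> I \<Longrightarrow> 0 < x i"
  shows "emeasure (exponent_measure I H) {w\<in>space (exponent_measure I H). \<exists>i\<in>I. ereal (x i) < w i} = ennreal (- ln (H x))"
proof -
  let ?M = "exponent_measure I H"
  let ?A = "E_set I - PiE I (\<lambda>i. {0..ereal (x i)})"
  let ?G = "{w\<in>space ?M. \<exists>i\<in>I. ereal (x i) < w i}"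
  have E: "E_set I = {w\<in>space ?M. (\<forall>i\<in>I. 0 \<le> w i) \<and> \<not> (\<forall>i\<in>I. w i = 0)}"
    by (auto simp: E_set_def space_exponent_measure space_PiM PiE_iff extensional_def fun_eq_iff)
  have E_sets: "E_set I \<in> sets ?M"
    unfolding E using finite_index by measurable
  have G: "?G \<in> sets ?M" using finite_index by measurable
  have AG: "?A = ?G \<inter> E_set I"
  proof -
    have "w \<in> PiE I (\<lambda>i. {0..ereal (x i)}) \<longleftrightarrow> (\<forall>i\<in>I. w i \<le> ereal (x i))" if "w \<in> E_set I" for w
      using that unfolding E by (simp add: space_exponent_measure space_PiM PiE_iff)
    note * = this
    have sub: "w \<in> space ?M" if "w \<in> E_set I" for w
      using sets.sets_into_space[OF E_sets] that by blast
    show ?thesis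
    proof (rule set_eqI)
      fix w show "w \<in> ?A \<longleftrightarrow> w \<in> ?G \<inter> E_set I"
        using *[of w] sub[of w] by (cases "w \<in> E_set I") (simp_all add: not_le)
    qed
  qed
  have "AE w in ?M. w \<in> E_set I"
    by (rule AE_I[where N="space ?M - E_set I"])
      (use exponent_measure E_sets in \<open>auto simp: is_exponent_measure_def\<close>)
  then have eq: "emeasure ?M ?A = emeasure ?M ?G"
    by (intro emeasure_eq_AE) (use G E_sets in \<open>auto simp: AG elim!: eventually_mono\<close>)
  \<comment> \<open>The defining property speaks of extensional points only; neither
    \<open>H\<close> nor the box sees the coordinates outside \<open>I\<close>.\<close>
  have r: "restrict x I \<in> PiE I (\<lambda>_. {0<..})" using x by auto
  have Hr: "H (restrict x I) = H x" by (rule df_cong[OF df]) simp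
  have PiEr: "PiE I (\<lambda>i. {0..ereal (restrict x I i)}) = PiE I (\<lambda>i. {0..ereal (x i)})"
    by (intro PiE_cong) simp
  have "(emeasure ?M ?A < \<infinity> \<and> H x = exp (- enn2real (emeasure ?M ?A))) \<or> (emeasure ?M ?A = \<infinity> \<and> H x = 0)"
    using exponent_measure r unfolding is_exponent_measure_def Let_def by (metis Hr PiEr)
  then have "emeasure ?M ?A < \<infinity>" "H x = exp (- enn2real (emeasure ?M ?A))"
    using pos[of x] x by auto
  then have "emeasure ?M ?A = ennreal (- ln (H x))" by simp
  then show ?thesis by (simp add: eq)
qed

text \<open>Levels outside \<open>T\<close> are sent to infinity along decreasing sets of finite
  mass. Points with an infinite coordinate there exceed every finite level and hence survive in the
  limit set.\<close>

lemma emeasure_exponent_measure_exceed_or_top: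
  assumes T: "T \<subseteq> I" and z: "\<And>i. i \<in> T \<Longrightarrow> 0 < z i"
  shows "emeasure (exponent_measure I H)
      {w\<in>space (exponent_measure I H). (\<exists>i\<in>T. ereal (z i) < w i) \<or> (\<exists>i\<in>I-T. w i = \<infinity>)} = ennreal (- ln (marg_df I H T z))"
proof -
  let ?M = "exponent_measure I H"
  define x where "x m i = (if i \<in> T then z i else real (Suc m))" for m i
  have x: "0 < x m i" if "i \<in> I" for m i using z by (simp add: x_def)
  let ?G = "\<lambda>m. {w\<in>space ?M. \<exists>i\<in>I. ereal (x m i) < w i}"
  have G: "range ?G \<subseteq> sets ?M" using finite_index by auto
  moreover have "decseq ?G"
  proof (rule decseq_SucI, rule subsetI)
    fix m w assume "w \<in> ?G (Suc m)"
    moreover have "ereal (x m i) \<le> ereal (x (Suc m) i)" for i by (simp add: x_def)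
    ultimately show "w \<in> ?G m" by (blast intro: le_less_trans)
  qed
  moreover have eG: "emeasure ?M (?G m) = ennreal (- ln (H (x m)))" for m
    by (rule emeasure_exponent_measure_exceed[OF x])
  ultimately have "(\<lambda>m. emeasure ?M (?G m)) \<longlonglongrightarrow> emeasure ?M (\<Inter>m. ?G m)"
    by (intro Lim_emeasure_decseq) auto
  then have "(\<lambda>m. ennreal (- ln (H (x m)))) \<longlonglongrightarrow> emeasure ?M (\<Inter>m. ?G m)"
    unfolding eG .
  moreover have "(\<lambda>m. ennreal (- ln (H (x m)))) \<longlonglongrightarrow> ennreal (- ln (marg_df I H T z))"
  proof -
    have "(\<lambda>m. H (x m)) \<longlonglongrightarrow> marg_df I H T z"
      using LIMSEQ_Suc[OF marg_df_LIMSEQ[OF finite_index df T, of z]] by (simp add: x_def[abs_def])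
    then show ?thesis
      using marg_df_pos[OF T, of z] z by (intro tendsto_ennrealI tendsto_minus tendsto_ln) auto
  qed
  ultimately have "emeasure ?M (\<Inter>m. ?G m) = ennreal (- ln (marg_df I H T z))"
    by (rule LIMSEQ_unique)
  also have "(\<Inter>m. ?G m) = {w\<in>space ?M. (\<exists>i\<in>T. ereal (z i) < w i) \<or> (\<exists>i\<in>I-T. w i = \<infinity>)}"
  proof (rule set_eqI)
    fix w
    have "(\<forall>m. \<exists>i\<in>I. ereal (x m i) < w i) \<longleftrightarrow> (\<exists>i\<in>T. ereal (z i) < w i) \<or> (\<exists>i\<in>I-T. w i = \<infinity>)"
    proof
      assume *: "\<forall>m. \<exists>i\<in>I. ereal (x m i) < w i"
      show "(\<exists>i\<in>T. ereal (z i) < w i) \<or> (\<exists>i\<in>I-T. w i = \<infinity>)"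
      proof (rule ccontr)
        assume **: "\<not> ?thesis"
        \<comment> \<open>A level above all finite coordinates of w can be exceeded only by an
          infinite one.\<close>
        define b where "b = Max (insert 0 ((\<lambda>i. real_of_ereal (w i)) ` I))"
        obtain m where m: "b < real m" using reals_Archimedean2 by blast
        obtain i where i: "i \<in> I" "ereal (x m i) < w i" using * by blast
        then have "i \<notin> T" using ** by (auto simp: x_def)
        with i ** have iT: "i \<notin> T" "w i \<noteq> \<infinity>" by blast+
        have "real_of_ereal (w i) \<le> b"
          unfolding b_def using finite_index i by (intro Max_ge) auto
        then show False using i iT m by (cases "w i") (auto simp: x_def)
      qed
    next
      assume "(\<exists>i\<in>T. ereal (z i) < w i) \<or> (\<exists>i\<in>I-T. w i = \<infinity>)"
      then obtain i where "i \<in> T \<and> ereal (z i) < w i \<or> i \<in> I - T \<and> w i = \<infinity>" by blast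
      then show "\<forall>m. \<exists>i\<in>I. ereal (x m i) < w i"
        using T by (intro allI bexI[of _ i]) (auto simp: x_def)
    qed
    then show "w \<in> (\<Inter>m. ?G m) \<longleftrightarrow> w \<in> {w\<in>space ?M. (\<exists>i\<in>T. ereal (z i) < w i) \<or> (\<exists>i\<in>I-T. w i = \<infinity>)}"
      by auto
  qed
  finally show ?thesis .
qed

text \<open>The case of empty T in \<open>emeasure_exponent_measure_exceed_or_top\<close>: the empty
  marginal is 1, with logarithm 0.\<close>

lemma AE_exponent_measure_finite: "AE w in exponent_measure I H. \<forall>i\<in>I. w i \<noteq> \<infinity>"
  by (rule AE_I[where N="{w\<in>space (exponent_measure I H). \<exists>i\<in>I. w i = \<infinity>}"])
    (use emeasure_exponent_measure_exceed_or_top[of "{}"] finite_index in \<open>auto simp: marg_df_empty\<close>)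

text \<open>\<open>real_of_ereal\<close> sends infinity to 0 and so loses exceedances at infinite
  coordinates; these form a null set. This is the union mass V_T required by
  \<open>integral_df_inclusion_exclusion\<close>.\<close>

lemma emeasure_exponent_measure_marginal:
  assumes T: "T \<subseteq> I" and z: "\<And>i. i \<in> T \<Longrightarrow> 0 < z i"
  shows "emeasure (exponent_measure I H) {w\<in>space (exponent_measure I H). \<exists>i\<in>T. z i < real_of_ereal (w i)}
    = ennreal (- ln (marg_df I H T z))"
proof -
  have fT: "finite T" using T finite_index finite_subset by auto
  have [measurable]: "(\<lambda>w. w i) \<in> borel_measurable (exponent_measure I H)" if "i \<in> T" for i
    using that T by auto
  have "AE w in exponent_measure I H. (\<exists>i\<in>T. z i < real_of_ereal (w i)) \<longleftrightarrow>
      (\<exists>i\<in>T. ereal (z i) < w i) \<or> (\<exists>i\<in>I-T. w i = \<infinity>)"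
    using AE_exponent_measure_finite
  proof eventually_elim
    fix w :: "nat \<Rightarrow> ereal" assume w: "\<forall>i\<in>I. w i \<noteq> \<infinity>"
    have "z i < real_of_ereal (w i) \<longleftrightarrow> ereal (z i) < w i" if "i \<in> T" for i
      using w z[OF that] that T by (cases "w i") auto
    then show "(\<exists>i\<in>T. z i < real_of_ereal (w i)) \<longleftrightarrow>
      (\<exists>i\<in>T. ereal (z i) < w i) \<or> (\<exists>i\<in>I-T. w i = \<infinity>)" using w by auto
  qed
  then have "emeasure (exponent_measure I H) {w\<in>space (exponent_measure I H). \<exists>i\<in>T. z i < real_of_ereal (w i)}
     = emeasure (exponent_measure I H)
      {w\<in>space (exponent_measure I H). (\<exists>i\<in>T. ereal (z i) < w i) \<or> (\<exists>i\<in>I-T. w i = \<infinity>)}"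
    by (intro emeasure_eq_AE) (use fT finite_index in \<open>auto elim!: eventually_mono\<close>)
  then show ?thesis using emeasure_exponent_measure_exceed_or_top[OF T z] by simp
qed

text \<open>Mass accumulates only at the origin: the sets exceeding 1/(n+1) in some coordinate have
  finite mass, and what they miss is null.\<close>

lemma sigma_finite_exponent_measure: "sigma_finite_measure (exponent_measure I H)"
proof
  let ?M = "exponent_measure I H"
  let ?G = "\<lambda>n. {w\<in>space ?M. \<exists>i\<in>I. ereal (1 / real (Suc n)) < w i}"
  let ?Z = "{w\<in>space ?M. \<forall>i\<in>I. w i \<le> 0}"
  have "?Z \<subseteq> space ?M - E_set I"
    by (auto simp: E_set_def space_exponent_measure space_PiM PiE_iff extensional_def fun_eq_iff) (metis antisym)
  moreover have "E_set I \<in> sets ?M"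
  proof -
    have "E_set I = {w\<in>space ?M. (\<forall>i\<in>I. 0 \<le> w i) \<and> \<not> (\<forall>i\<in>I. w i = 0)}"
      by (auto simp: E_set_def space_exponent_measure space_PiM PiE_iff extensional_def fun_eq_iff)
    also have "\<dots> \<in> sets ?M" using finite_index by measurable
    finally show ?thesis .
  qed
  ultimately have "emeasure ?M ?Z \<le> emeasure ?M (space ?M - E_set I)"
    by (intro emeasure_mono) auto
  then have Z: "emeasure ?M ?Z = 0" using exponent_measure by (simp add: is_exponent_measure_def)
  have G: "emeasure ?M (?G n) \<noteq> \<infinity>" for n
    using emeasure_exponent_measure_exceed[of "\<lambda>_. 1 / real (Suc n)"] by simp
  have "w \<in> ?Z \<or> (\<exists>n. w \<in> ?G n)" if w: "w \<in> space ?M" for w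
  proof (rule disjCI)
    assume *: "\<not> (\<exists>n. w \<in> ?G n)"
    have "w i \<le> 0" if i: "i \<in> I" for i
    proof (rule LIMSEQ_le_const)
      show "(\<lambda>n. ereal (1 / real (Suc n))) \<longlonglongrightarrow> 0"
        unfolding zero_ereal_def lim_ereal by real_asymp
      show "\<exists>N. \<forall>n\<ge>N. w i \<le> ereal (1 / real (Suc n))"
        using * w i by (auto simp: not_less)
    qed
    then show "w \<in> ?Z" using w by simp
  qed
  then have "\<Union> (insert ?Z (range ?G)) = space ?M" by auto
  moreover have "?Z \<in> sets ?M" "?G n \<in> sets ?M" for n using finite_index by measurable
  ultimately show "\<exists>A. countable A \<and> A \<subseteq> sets ?M \<and> \<Union> A = space ?M \<and> (\<forall>a\<in>A. emeasure ?M a \<noteq> \<infinity>)"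
    using Z G by (intro exI[of _ "insert ?Z (range ?G)"]) auto
qed

end

section \<open>The functionals mu and lambda\<close>

context max_id_frechet
begin

lemma minus_ln_marg_df_bounds:
  assumes "T \<subseteq> I" "T \<noteq> {}" "\<And>i. i \<in> T \<Longrightarrow> 0 < z i"
  shows "0 \<le> - ln (marg_df I H T z)" "- ln (marg_df I H T z) \<le> (\<Sum>i\<in>T. 1 / z i)"
proof -
  interpret T: max_id_frechet T "marg_df I H T" by (rule max_id_frechet_marg_df[OF assms(1,2)])
  show "0 \<le> - ln (marg_df I H T z)" "- ln (marg_df I H T z) \<le> (\<Sum>i\<in>T. 1 / z i)"
    using T.minus_ln_bounds[of z] assms(3) by auto
qed

lemma marg_df_singleton: "i \<in> I \<Longrightarrow> marg_df I H {i} z = frechet (z i)"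
  using prob_margin[of i "z i"] by (simp add: marg_df_eq[OF df])

end

section \<open>Pairs of df's: limits and inclusion-exclusion for mu and lambda\<close>

locale max_id_frechet_pair = max_id_frechet I H + Q: frechet_df I Q for I H Q
begin

abbreviation dQ :: "(nat \<Rightarrow> real) measure" where "dQ \<equiv> df_measure I Q"

lemma borel_measurable_marg_df[measurable]:
  assumes T: "T \<subseteq> I"
  shows "(\<lambda>z. marg_df I H T z) \<in> borel_measurable dQ"
  using T finite_index finite_subset
  by (intro borel_measurable_df[OF _ is_df_marg_df[OF finite_index df T]]) auto

lemma integrable_sum_inverse: "T \<subseteq> I \<Longrightarrow> integrable dQ (\<lambda>z. \<Sum>i\<in>T. 1 / z i)"
  by (intro Bochner_Integration.integrable_sum Q.has_expectation_inverse) auto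

lemma integrable_minus_ln:
  assumes T: "T \<subseteq> I" "T \<noteq> {}"
  shows "integrable dQ (\<lambda>z. - ln (marg_df I H T z))"
proof (rule Bochner_Integration.integrable_bound[OF integrable_sum_inverse[OF T(1)]])
  show "(\<lambda>z. - ln (marg_df I H T z)) \<in> borel_measurable dQ" using T by measurable
  show "AE z in dQ. norm (- ln (marg_df I H T z)) \<le> norm (\<Sum>i\<in>T. 1 / z i)"
    using Q.AE_pos
  proof eventually_elim
    fix z :: "nat \<Rightarrow> real" assume "\<forall>i\<in>I. 0 < z i"
    then have z: "0 < z i" if "i \<in> T" for i using that T by auto
    show "norm (- ln (marg_df I H T z)) \<le> norm (\<Sum>i\<in>T. 1 / z i)"
      using minus_ln_marg_df_bounds[of T z] T z by simp
  qed
qed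

lemma mu_marg_df:
  assumes T: "T \<subseteq> I"
  shows "mu T (marg_df I H T) (marg_df I Q T) = (\<integral>z. - ln (marg_df I H T z) \<partial>dQ)"
  using integral_marg_df[OF finite_index Q.df T is_df_marg_df[OF finite_index df T], of ln]
  unfolding mu_def by simp

text \<open>Dominated convergence, with the union bound as majorant. All marginals are treated at
  once because the limit for lambda is assembled from them.\<close>

lemma mu_LIMSEQ:
  assumes T: "T \<subseteq> I" "T \<noteq> {}"
  shows "(\<lambda>n. real n * (\<integral>z. 1 - marg_df I H T z powr (1 / real n) \<partial>dQ))
    \<longlonglongrightarrow> mu T (marg_df I H T) (marg_df I Q T)"
proof -
  interpret T: max_id_frechet T "marg_df I H T" by (rule max_id_frechet_marg_df[OF T])
  have "(\<lambda>n. \<integral>z. real n * (1 - marg_df I H T z powr (1 / real n)) \<partial>dQ) \<longlonglongrightarrow> (\<integral>z. - ln (marg_df I H T z) \<partial>dQ)"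
  proof (rule integral_dominated_convergence)
    show "integrable dQ (\<lambda>z. \<Sum>i\<in>T. 1 / z i)" by (rule integrable_sum_inverse[OF T(1)])
    show "AE z in dQ. (\<lambda>n. real n * (1 - marg_df I H T z powr (1 / real n))) \<longlonglongrightarrow> - ln (marg_df I H T z)"
      using Q.AE_pos by eventually_elim (use T in \<open>auto intro!: T.scaled_one_minus_powr_LIMSEQ\<close>)
    show "AE z in dQ. norm (real n * (1 - marg_df I H T z powr (1 / real n))) \<le> (\<Sum>i\<in>T. 1 / z i)" for n
      using Q.AE_pos
    proof eventually_elim
      fix z :: "nat \<Rightarrow> real" assume "\<forall>i\<in>I. 0 < z i"
      then have z: "0 < z i" if "i \<in> T" for i using that T by auto
      have le1: "marg_df I H T z powr (1 / real n) \<le> 1"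
        using df_nonneg[OF T.df, of z] df_le_1[OF T.df, of z] by (intro powr_le1) auto
      show "norm (real n * (1 - marg_df I H T z powr (1 / real n))) \<le> (\<Sum>i\<in>T. 1 / z i)"
      proof (cases "n = 0")
        case True
        then show ?thesis using z by (auto intro!: sum_nonneg intro: less_imp_le)
      next
        case False
        then have "real n * (1 - marg_df I H T z powr (1 / real n)) \<le> real n * (1 / real n * (\<Sum>i\<in>T. 1 / z i))"
          using z by (intro mult_left_mono T.one_minus_powr_le) auto
        then show ?thesis using le1 False by simp
      qed
    qed
  qed (use T in measurable)
  then show ?thesis unfolding mu_marg_df[OF T(1)] by simp
qed

lemma integral_powr_inclusion_exclusion:
  assumes s: "0 < s"
  shows "(\<integral>x. Q x \<partial>df_measure I (\<lambda>x. H x powr s)) =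
    (\<Sum>T\<in>Pow I - {{}}. (-1) ^ (card T + 1) * (\<integral>z. 1 - marg_df I H T z powr s \<partial>dQ))"
proof -
  let ?M = "df_measure I (\<lambda>x. H x powr s)"
  interpret M: prob_space ?M by (rule prob_space_df_measure[OF df_powr[OF s]])
  have [measurable]: "(\<lambda>z. z i) \<in> borel_measurable ?M" if "i \<in> I" for i
    by (rule df_measurable[OF df_powr[OF s] that])
  have marg_le1: "marg_df I H T z powr s \<le> 1" if "T \<subseteq> I" for T z
    using df_nonneg[OF is_df_marg_df[OF finite_index df that], of z]
      df_le_1[OF is_df_marg_df[OF finite_index df that], of z] s
    by (intro powr_le1) auto
  have exceed: "emeasure ?M {w\<in>space ?M. \<exists>i\<in>T. z i < w i} = ennreal (1 - marg_df I H T z powr s)"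
    if T: "T \<subseteq> I" for T z
  proof -
    have fT: "finite T" using T finite_index finite_subset by auto
    have "{w\<in>space ?M. \<exists>i\<in>T. z i < w i} = space ?M - {w\<in>space ?M. \<forall>i\<in>T. w i \<le> z i}"
      by (auto simp: not_le)
    moreover have "M.prob {w\<in>space ?M. \<forall>i\<in>T. w i \<le> z i} = marg_df I H T z powr s"
      using marg_df_eq[OF df_powr[OF s] T, of z] marg_df_powr[OF s T, of z] by simp
    ultimately show ?thesis
      using sets_orthant[OF fT T sets_df_measure[OF df_powr[OF s]], of z]
      by (simp add: M.emeasure_eq_measure M.prob_compl)
  qed
  have "(\<integral>x. Q x \<partial>?M) = (\<integral>w. measure dQ {z\<in>space dQ. \<forall>i\<in>I. z i \<le> w i} \<partial>?M)"
    by (simp add: df_eq_measure[OF Q.df, symmetric])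
  also have "\<dots> = (\<Sum>T\<in>Pow I - {{}}. (-1) ^ (card T + 1) * (\<integral>z. 1 - marg_df I H T z powr s \<partial>dQ))"
  proof (rule integral_df_inclusion_exclusion[OF finite_index index_nonempty _ Q.prob_space_axioms sets_df_measure[OF Q.df]])
    show "sigma_finite_measure ?M" by unfold_locales
    show "AE z in dQ. \<forall>i\<in>I. 0 < z i" by (rule Q.AE_pos)
    show "emeasure ?M {w\<in>space ?M. w i = t} = 0" if i: "i \<in> I" and t: "0 < t" for i t
    \<comment> \<open>The margins of the s-th power of \<open>H\<close> are powers of the Frechet
      df, continuous at positive t.\<close>
    proof (rule emeasure_atom_eq_0[where v="\<lambda>t. 1 - exp (- 1 / t) powr s"])
      show "emeasure ?M {w\<in>space ?M. u < w i} = ennreal (1 - exp (- 1 / u) powr s)" if "0 < u" for u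
        using exceed[of "{i}" "\<lambda>_. u"] marg_df_singleton[OF i, of "\<lambda>_. u"] i that
        by (simp add: frechet_def)
      show "0 \<le> 1 - exp (- 1 / u) powr s" if "0 < u" for u
        using that s by (simp add: powr_le1)
      show "isCont (\<lambda>t. 1 - exp (- 1 / t) powr s) t"
        using t by (intro continuous_intros) auto
    qed (use i t in auto)
    show "integrable dQ (\<lambda>z. 1 - marg_df I H T z powr s)" if "T \<subseteq> I" for T
    proof (rule Q.integrable_const_bound[where B=1])
      show "AE z in dQ. norm (1 - marg_df I H T z powr s) \<le> 1"
        using marg_le1[OF that] by (auto simp: abs_le_iff)
    qed (use that in measurable)
  qed (use exceed marg_le1 in auto)
  finally show ?thesis .
qed

lemma lam_inclusion_exclusion:
  "lam I Q H = (\<Sum>T\<in>Pow I - {{}}. (-1) ^ (card T + 1) * mu T (marg_df I H T) (marg_df I Q T))"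
proof -
  let ?M = "exponent_measure I H"
  have Q0: "Q z = 0" if "i \<in> I" "z i \<le> 0" for z i
    using Q.le_frechet[OF that(1), of z] df_nonneg[OF Q.df, of z] that by (simp add: frechet_def)
  have "lam I Q H = (\<integral>w. Q (\<lambda>i. real_of_ereal (w i)) \<partial>?M)"
    unfolding lam_def set_lebesgue_integral_def
  proof (rule Bochner_Integration.integral_cong[OF refl])
    fix w assume w: "w \<in> space ?M"
    have "Q (\<lambda>i. real_of_ereal (w i)) = 0" if nb: "w \<notin> PiE I (\<lambda>_. {0<..<\<infinity>})"
    proof -
      obtain i where "i \<in> I" "w i \<notin> {0<..<\<infinity>}"
        using w nb unfolding space_exponent_measure space_PiM PiE_iff by blast
      then show ?thesis by (intro Q0[of i]) (cases "w i"; auto)+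
    qed
    then show "indicat_real (PiE I (\<lambda>_. {0<..<\<infinity>})) w *\<^sub>R Q (\<lambda>i. real_of_ereal (w i)) = Q (\<lambda>i. real_of_ereal (w i))"
      by (auto simp: indicator_def)
  qed
  also have "\<dots> = (\<integral>w. measure dQ {z\<in>space dQ. \<forall>i\<in>I. z i \<le> real_of_ereal (w i)} \<partial>?M)"
    by (simp add: df_eq_measure[OF Q.df, symmetric])
  also have "\<dots> = (\<Sum>T\<in>Pow I - {{}}. (-1) ^ (card T + 1) * (\<integral>z. - ln (marg_df I H T z) \<partial>dQ))"
  proof (rule integral_df_inclusion_exclusion[OF finite_index index_nonempty sigma_finite_exponent_measure
        Q.prob_space_axioms sets_df_measure[OF Q.df]])
    show "AE z in dQ. \<forall>i\<in>I. 0 < z i" by (rule Q.AE_pos)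
    show "emeasure ?M {w\<in>space ?M. \<exists>i\<in>T. z i < real_of_ereal (w i)} = ennreal (- ln (marg_df I H T z))"
      if "T \<subseteq> I" "T \<noteq> {}" "\<forall>i\<in>I. 0 < z i" for T z
      using that by (intro emeasure_exponent_measure_marginal) auto
    show "0 \<le> - ln (marg_df I H T z)" if "T \<subseteq> I" "T \<noteq> {}" "\<forall>i\<in>I. 0 < z i" for T z
      using that by (intro minus_ln_marg_df_bounds) auto
    show "emeasure ?M {w\<in>space ?M. real_of_ereal (w i) = t} = 0" if i: "i \<in> I" and t: "0 < t" for i t
    \<comment> \<open>The one-dimensional exponent tail is -ln exp(-1/t) = 1/t.\<close>
    proof (rule emeasure_atom_eq_0[where v="\<lambda>t. 1 / t"])
      show "emeasure ?M {w\<in>space ?M. u < real_of_ereal (w i)} = ennreal (1 / u)" if "0 < u" for u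
        using emeasure_exponent_measure_marginal[of "{i}" "\<lambda>_. u"] marg_df_singleton[OF i, of "\<lambda>_. u"] i that
        by (simp add: frechet_def)
      show "isCont (\<lambda>t. 1 / t) t" using t by (intro continuous_intros) auto
    qed (use i t in auto)
    show "integrable dQ (\<lambda>z. - ln (marg_df I H T z))" if "T \<subseteq> I" "T \<noteq> {}" for T
      using that by (rule integrable_minus_ln)
  qed simp
  also have "\<dots> = (\<Sum>T\<in>Pow I - {{}}. (-1) ^ (card T + 1) * mu T (marg_df I H T) (marg_df I Q T))"
    by (intro sum.cong refl) (simp add: mu_marg_df)
  finally show ?thesis .
qed

lemma lam_LIMSEQ:
  "(\<lambda>n. real n * (\<integral>x. Q x \<partial>df_measure I (\<lambda>x. H x powr (1 / real n)))) \<longlonglongrightarrow> lam I Q H"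
proof -
  have "(\<lambda>n. \<Sum>T\<in>Pow I - {{}}. (-1) ^ (card T + 1) * (real n * (\<integral>z. 1 - marg_df I H T z powr (1 / real n) \<partial>dQ)))
      \<longlonglongrightarrow> lam I Q H"
    unfolding lam_inclusion_exclusion by (intro tendsto_sum tendsto_mult tendsto_const mu_LIMSEQ) auto
  then show ?thesis
  proof (rule Lim_transform_eventually)
    \<comment> \<open>The identity for powers requires a positive exponent together with the
      cancellation-free factor n, which is available for positive n.\<close>
    show "eventually (\<lambda>n. (\<Sum>T\<in>Pow I - {{}}. (-1) ^ (card T + 1) * (real n * (\<integral>z. 1 - marg_df I H T z powr (1 / real n) \<partial>dQ)))
        = real n * (\<integral>x. Q x \<partial>df_measure I (\<lambda>x. H x powr (1 / real n)))) sequentially"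
      using eventually_gt_at_top[of 0]
    proof eventually_elim
      fix n :: nat assume "0 < n"
      then show "(\<Sum>T\<in>Pow I - {{}}. (-1) ^ (card T + 1) * (real n * (\<integral>z. 1 - marg_df I H T z powr (1 / real n) \<partial>dQ)))
        = real n * (\<integral>x. Q x \<partial>df_measure I (\<lambda>x. H x powr (1 / real n)))"
        by (subst integral_powr_inclusion_exclusion) (auto simp: sum_distrib_left mult.left_commute)
    qed
  qed
qed

lemma max_id_frechet_pair_marg_df:
  "T \<subseteq> I \<Longrightarrow> T \<noteq> {} \<Longrightarrow> max_id_frechet_pair T (marg_df I H T) (marg_df I Q T)"
  by (intro max_id_frechet_pair.intro max_id_frechet_marg_df Q.frechet_df_marg_df)

lemma lam_marg_df_inclusion_exclusion:
  assumes K: "K \<subseteq> I" "K \<noteq> {}"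
  shows "lam K (marg_df I Q K) (marg_df I H K)
    = (\<Sum>T\<in>Pow K - {{}}. (-1) ^ (card T + 1) * mu T (marg_df I H T) (marg_df I Q T))"
proof -
  interpret K: max_id_frechet_pair K "marg_df I H K" "marg_df I Q K"
    by (rule max_id_frechet_pair_marg_df[OF K])
  show ?thesis
    unfolding K.lam_inclusion_exclusion
    by (intro sum.cong refl)
      (simp add: marg_df_marg_df[OF finite_index df K(1)] marg_df_marg_df[OF finite_index Q.df K(1)])
qed

text \<open>The formula for lambda holds for every marginal K, and its summand at T does not depend
  on K since marginals of marginals are marginals. The family of lambda values is thus a signed
  subset transform of the mu values, and this transform is its own inverse.\<close>

lemma mu_inclusion_exclusion:
  "mu I (marg_df I H I) (marg_df I Q I)
    = (\<Sum>K\<in>Pow I - {{}}. (-1) ^ (card K + 1) * lam K (marg_df I Q K) (marg_df I H K))"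
proof -
  \<comment> \<open>Extended by 0 so that the inversion theorem, stated for all finite sets,
    applies; the sign absorbs the shift from card T + 1 to card T.\<close>
  define f where "f T = (if T = {} \<or> \<not> T \<subseteq> I then 0 else - mu T (marg_df I H T) (marg_df I Q T))" for T
  define g where "g S = (\<Sum>T\<in>Pow S. (-1) ^ card T * f T)" for S
  have g: "g K = lam K (marg_df I Q K) (marg_df I H K)" if K: "K \<subseteq> I" "K \<noteq> {}" for K
  proof -
    have "finite K" using K finite_index finite_subset by auto
    then have "g K = (\<Sum>T\<in>Pow K - {{}}. (-1) ^ card T * f T)"
      unfolding g_def by (intro sum.mono_neutral_right) (auto simp: f_def)
    also have "\<dots> = (\<Sum>T\<in>Pow K - {{}}. (-1) ^ (card T + 1) * mu T (marg_df I H T) (marg_df I Q T))"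
      using K by (intro sum.cong refl) (auto simp: f_def)
    finally show ?thesis by (simp only: lam_marg_df_inclusion_exclusion[OF K])
  qed
  have "f I = (\<Sum>K\<in>Pow I. (-1) ^ card K * g K)"
    by (rule inclusion_exclusion_symmetric[OF g_def finite_index])
  also have "\<dots> = (\<Sum>K\<in>Pow I - {{}}. (-1) ^ card K * g K)"
    using finite_index by (intro sum.mono_neutral_right) (auto simp: g_def f_def)
  also have "\<dots> = (\<Sum>K\<in>Pow I - {{}}. (-1) ^ card K * lam K (marg_df I Q K) (marg_df I H K))"
    by (intro sum.cong refl) (auto simp: g)
  finally show ?thesis
    using index_nonempty by (simp add: f_def sum_negf)
qed

text \<open>In one dimension -ln H is 1/z, whose mean is 1.\<close>

lemma mu_singleton:
  assumes i: "i \<in> I"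
  shows "mu {i} (marg_df I H {i}) (marg_df I Q {i}) = 1"
proof -
  have "(\<integral>z. - ln (marg_df I H {i} z) \<partial>dQ) = (\<integral>z. 1 / z i \<partial>dQ)"
  proof (rule integral_cong_AE)
    show "AE z in dQ. - ln (marg_df I H {i} z) = 1 / z i"
      using Q.AE_pos by eventually_elim (use i in \<open>simp add: marg_df_singleton frechet_def\<close>)
  qed (use i borel_measurable_marg_df[of "{i}"] in auto)
  then show ?thesis using mu_marg_df[of "{i}"] Q.has_expectation_inverse(2)[OF i] i by simp
qed

lemma lam_singleton: "i \<in> I \<Longrightarrow> lam {i} (marg_df I Q {i}) (marg_df I H {i}) = 1"
proof -
  assume i: "i \<in> I"
  have "Pow {i} - {{}} = {{i}}" by auto
  then show ?thesis using i by (simp add: lam_marg_df_inclusion_exclusion mu_singleton)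
qed

end

text \<open>Grouping by cardinality: the d singletons, with sign +1 and value 1, form the summand
  d.\<close>

lemma sum_Pow_by_card:
  fixes F :: "nat set \<Rightarrow> real"
  assumes d: "d \<ge> 1" and F: "\<And>i. i \<in> {1..d} \<Longrightarrow> F {i} = 1"
  shows "(\<Sum>K\<in>Pow {1..d} - {{}}. (-1) ^ (card K + 1) * F K)
    = real d + (\<Sum>i=2..d. (-1) ^ (i + 1) * (\<Sum>K\<in>{K. K \<subseteq> {1..d} \<and> card K = i}. F K))"
proof -
  let ?P = "Pow {1..d} - {{}}"
  have "(\<Sum>K\<in>?P. (-1) ^ (card K + 1) * F K) = (\<Sum>i\<in>{1..d}. \<Sum>K\<in>{K\<in>?P. card K = i}. (-1) ^ (card K + 1) * F K)"
  proof (rule sum.group[symmetric])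
    show "card ` ?P \<subseteq> {1..d}"
    proof (rule image_subsetI)
      fix K assume K: "K \<in> ?P"
      then have "finite K" using finite_subset[of K "{1..d}"] by auto
      with K show "card K \<in> {1..d}"
        using card_mono[of "{1..d}" K] by (auto simp: Suc_le_eq card_gt_0_iff)
    qed
  qed auto
  also have "\<dots> = (\<Sum>i\<in>{1..d}. (-1) ^ (i + 1) * (\<Sum>K\<in>{K. K \<subseteq> {1..d} \<and> card K = i}. F K))"
  proof (intro sum.cong refl)
    fix i assume "i \<in> {1..d}"
    then have "{K\<in>?P. card K = i} = {K. K \<subseteq> {1..d} \<and> card K = i}" by auto
    then show "(\<Sum>K\<in>{K\<in>?P. card K = i}. (-1) ^ (card K + 1) * F K)
        = (-1) ^ (i + 1) * (\<Sum>K\<in>{K. K \<subseteq> {1..d} \<and> card K = i}. F K)"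
      by (simp add: sum_distrib_left)
  qed
  also have "\<dots> = (-1) ^ (1 + 1) * (\<Sum>K\<in>{K. K \<subseteq> {1..d} \<and> card K = 1}. F K)
      + (\<Sum>i=Suc 1..d. (-1) ^ (i + 1) * (\<Sum>K\<in>{K. K \<subseteq> {1..d} \<and> card K = i}. F K))"
    by (rule sum.atLeast_Suc_atMost[OF d])
  also have "(\<Sum>K\<in>{K. K \<subseteq> {1..d} \<and> card K = 1}. F K) = real d"
  proof -
    have "{K. K \<subseteq> {1..d} \<and> card K = 1} = (\<lambda>i. {i}) ` {1..d}" by (auto simp: card_1_singleton_iff)
    then show ?thesis using F by (simp add: sum.reindex)
  qed
  finally show ?thesis by (simp add: numeral_2_eq_2)
qed

theorem theorem2p1:
  fixes d :: nat and H Q :: "(nat \<Rightarrow> real) \<Rightarrow> real"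
  assumes "d \<ge> 1"
    and "max_id {1..d} H" and "unit_frechet_margins {1..d} H"
    and "is_df {1..d} Q" and "unit_frechet_margins {1..d} Q"
  shows "((\<lambda>n. real n * (\<integral>x. (1 - H x powr (1 / real n)) \<partial>(df_measure {1..d} Q)))
           \<longlonglongrightarrow> mu {1..d} H Q) \<and>
        ((\<lambda>n. real n * (\<integral>x. Q x \<partial>(df_measure {1..d} (\<lambda>x. H x powr (1 / real n)))))
           \<longlonglongrightarrow> lam {1..d} Q H) \<and>
        (mu {1..d} H Q = real d + (\<Sum>i=2..d. (-1) ^ (i + 1) *
           (\<Sum>K\<in>{K. K \<subseteq> {1..d} \<and> card K = i}. lam K (marg_df {1..d} Q K) (marg_df {1..d} H K)))) \<and>
        (lam {1..d} Q H = real d + (\<Sum>i=2..d. (-1) ^ (i + 1) *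
           (\<Sum>K\<in>{K. K \<subseteq> {1..d} \<and> card K = i}. mu K (marg_df {1..d} H K) (marg_df {1..d} Q K)))) \<and>
        (d = 2 \<longrightarrow> mu {1..d} H Q = 2 - lam {1..d} Q H)"
proof -
  interpret max_id_frechet_pair "{1..d}" H Q
    using assms by unfold_locales (auto simp: max_id_def)
  note self = marg_df_self[OF df] marg_df_self[OF Q.df]
  have ne: "{1..d} \<noteq> {}" by (rule index_nonempty)
  have mu: "mu {1..d} H Q = real d + (\<Sum>i=2..d. (-1) ^ (i + 1) *
      (\<Sum>K\<in>{K. K \<subseteq> {1..d} \<and> card K = i}. lam K (marg_df {1..d} Q K) (marg_df {1..d} H K)))"
    using mu_inclusion_exclusion lam_singleton unfolding self
    by (subst sum_Pow_by_card[OF assms(1), symmetric]) auto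
  have lam: "lam {1..d} Q H = real d + (\<Sum>i=2..d. (-1) ^ (i + 1) *
      (\<Sum>K\<in>{K. K \<subseteq> {1..d} \<and> card K = i}. mu K (marg_df {1..d} H K) (marg_df {1..d} Q K)))"
    using lam_inclusion_exclusion mu_singleton
    by (subst sum_Pow_by_card[OF assms(1), symmetric]) auto
  \<comment> \<open>The only set of cardinality 2 is the full index set, entering with sign (-1)^3,
    and its marginals are \<open>H\<close> and \<open>Q\<close> themselves.\<close>
  have "mu {1..d} H Q = 2 - lam {1..d} Q H" if d2: "d = 2"
  proof -
    have "{K. K \<subseteq> {1..d} \<and> card K = 2} = {{1..d}}"
      using d2 card_subset_eq[of "{1..d}"] by auto
    then show ?thesis using mu d2 self by simp
  qed
  then show ?thesis
    using mu lam lam_LIMSEQ mu_LIMSEQ[OF order_refl ne] unfolding self by blast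
qed

end
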